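(* Let $n\ge 1$, let $k$ be a field of characteristic $0$, let $\lambda$ be a partition of $n$, and let $m_\lambda$ be the number of standard Young tableaux of shape $\lambda$. Then there exist an invertible constant $m_\lambda\times m_\lambda$ matrix $c$ over $k$ and, for each $s\in S_n$, an $m_\lambda\times m_\lambda$ matrix $X(s)$ all of whose entries lie in $\{-1,0,+1\}$, such that $$X(st)=X(s)\,c\,X(t)\qquad\text{for all } s,t\in S_n,$$ and such that $s\mapsto X(s)\,c$ is a matrix representation of $S_n$ equivalent to the irreducible representation of $S_n$ over $k$ indexed by $\lambda$.
   Context: In the paper, a family of matrices $X(s)$, $s\in S_n$, satisfying $X(st)=X(s)\,c\,X(t)$ for a fixed invertible matrix $c$ is called a representation with matrix $c$ (the matrix product is twisted by the constant matrix $c$). The irreducible representation indexed by $\lambda$ is the one afforded by the left ideal $kS_n\,P\,N$, where, for a tableau $T$ of shape $\lambda$, $P$ is the sum of all permutations preserving each row of $T$ and $N$ is the signed sum (sign $=$ parity) of all permutations preserving each column of $T$. *)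

theory Defs
  imports "HOL-Algebra.Sym_Groups" "Jordan_Normal_Form.Matrix"
begin

definition is_partition :: "nat \<Rightarrow> nat list \<Rightarrow> bool" where
  "is_partition n lam \<longleftrightarrow> sorted_wrt (\<ge>) lam \<and> 0 \<notin> set lam \<and> sum_list lam = n"

text \<open>Cells are pairs (row, column), both counted from 0.\<close>

definition diagram :: "nat list \<Rightarrow> (nat \<times> nat) set" where
  "diagram lam = {(i, j). i < length lam \<and> j < lam ! i}"

text \<open>A tableau is undefined outside the diagram, so that the set of standard tableaux is finite
  and its cardinality is the intended one.\<close>

definition is_tableau :: "nat \<Rightarrow> nat list \<Rightarrow> (nat \<times> nat \<Rightarrow> nat) \<Rightarrow> bool" where
  "is_tableau n lam T \<longleftrightarrow> T \<in> extensional (diagram lam) \<and> bij_betw T (diagram lam) {1..n}"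

definition is_standard :: "nat list \<Rightarrow> (nat \<times> nat \<Rightarrow> nat) \<Rightarrow> bool" where
  "is_standard lam T \<longleftrightarrow>
     (\<forall>i j j'. (i, j) \<in> diagram lam \<and> (i, j') \<in> diagram lam \<and> j < j' \<longrightarrow> T (i, j) < T (i, j')) \<and>
     (\<forall>i i' j. (i, j) \<in> diagram lam \<and> (i', j) \<in> diagram lam \<and> i < i' \<longrightarrow> T (i, j) < T (i', j))"

definition num_SYT :: "nat \<Rightarrow> nat list \<Rightarrow> nat" where
  "num_SYT n lam = card {T. is_tableau n lam T \<and> is_standard lam T}"

definition row_entries :: "nat list \<Rightarrow> (nat \<times> nat \<Rightarrow> nat) \<Rightarrow> nat \<Rightarrow> nat set" where
  "row_entries lam T i = T ` {(i', j) \<in> diagram lam. i' = i}"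

definition column_entries :: "nat list \<Rightarrow> (nat \<times> nat \<Rightarrow> nat) \<Rightarrow> nat \<Rightarrow> nat set" where
  "column_entries lam T j = T ` {(i, j') \<in> diagram lam. j' = j}"

definition row_group :: "nat \<Rightarrow> nat list \<Rightarrow> (nat \<times> nat \<Rightarrow> nat) \<Rightarrow> (nat \<Rightarrow> nat) set" where
  "row_group n lam T =
     {p \<in> carrier (sym_group n). \<forall>i. p ` row_entries lam T i = row_entries lam T i}"

definition column_group :: "nat \<Rightarrow> nat list \<Rightarrow> (nat \<times> nat \<Rightarrow> nat) \<Rightarrow> (nat \<Rightarrow> nat) set" where
  "column_group n lam T =
     {p \<in> carrier (sym_group n). \<forall>j. p ` column_entries lam T j = column_entries lam T j}"

text \<open>An element of the group algebra of \<open>sym_group n\<close> is its coefficient function, extended by 0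
  to arguments that are not in the group.\<close>

definition group_algebra :: "nat \<Rightarrow> ((nat \<Rightarrow> nat) \<Rightarrow> 'k::field) set" where
  "group_algebra n = {x. \<forall>p. p \<notin> carrier (sym_group n) \<longrightarrow> x p = 0}"

definition ga_of :: "(nat \<Rightarrow> nat) \<Rightarrow> (nat \<Rightarrow> nat) \<Rightarrow> 'k::field" where
  "ga_of s = (\<lambda>p. if p = s then 1 else 0)"

definition ga_mult ::
    "nat \<Rightarrow> ((nat \<Rightarrow> nat) \<Rightarrow> 'k::field) \<Rightarrow> ((nat \<Rightarrow> nat) \<Rightarrow> 'k) \<Rightarrow> (nat \<Rightarrow> nat) \<Rightarrow> 'k" where
  "ga_mult n x y = (\<lambda>p. \<Sum>(s, t) \<in> {(s, t). s \<in> carrier (sym_group n) \<and> t \<in> carrier (sym_group n) \<and>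
       s \<otimes>\<^bsub>sym_group n\<^esub> t = p}. x s * y t)"

definition row_sum :: "nat \<Rightarrow> nat list \<Rightarrow> (nat \<times> nat \<Rightarrow> nat) \<Rightarrow> (nat \<Rightarrow> nat) \<Rightarrow> 'k::field" where
  "row_sum n lam T = (\<lambda>p. \<Sum>s \<in> row_group n lam T. ga_of s p)"

definition column_sum :: "nat \<Rightarrow> nat list \<Rightarrow> (nat \<times> nat \<Rightarrow> nat) \<Rightarrow> (nat \<Rightarrow> nat) \<Rightarrow> 'k::field" where
  "column_sum n lam T = (\<lambda>p. \<Sum>s \<in> column_group n lam T. of_int (sign s) * ga_of s p)"

definition young_ideal ::
    "nat \<Rightarrow> nat list \<Rightarrow> (nat \<times> nat \<Rightarrow> nat) \<Rightarrow> ((nat \<Rightarrow> nat) \<Rightarrow> 'k::field) set" where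
  "young_ideal n lam T =
     {ga_mult n (ga_mult n x (row_sum n lam T)) (column_sum n lam T) | x. x \<in> group_algebra n}"

definition matrix_representation :: "nat \<Rightarrow> nat \<Rightarrow> ((nat \<Rightarrow> nat) \<Rightarrow> 'k::field mat) \<Rightarrow> bool" where
  "matrix_representation n m M \<longleftrightarrow>
     M \<in> hom (sym_group n) (units_of (ring_mat TYPE('k) m ()))"

text \<open>Equivalence of the representation \<open>M\<close> on column vectors with the action of the symmetric
  group by left multiplication on a left ideal \<open>L\<close>: an invertible linear intertwiner.\<close>

definition equivalent_to_ideal ::
    "nat \<Rightarrow> nat \<Rightarrow> ((nat \<Rightarrow> nat) \<Rightarrow> 'k::field mat) \<Rightarrow> ((nat \<Rightarrow> nat) \<Rightarrow> 'k) set \<Rightarrow> bool" where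
  "equivalent_to_ideal n m M L \<longleftrightarrow>
     (\<exists>\<phi>. bij_betw \<phi> (carrier_vec m) L \<and>
        (\<forall>v \<in> carrier_vec m. \<forall>w \<in> carrier_vec m. \<phi> (v + w) = (\<lambda>p. \<phi> v p + \<phi> w p)) \<and>
        (\<forall>a. \<forall>v \<in> carrier_vec m. \<phi> (a \<cdot>\<^sub>v v) = (\<lambda>p. a * \<phi> v p)) \<and>
        (\<forall>s \<in> carrier (sym_group n). \<forall>v \<in> carrier_vec m.
           \<phi> (M s *\<^sub>v v) = ga_mult n (ga_of s) (\<phi> v)))"

text \<open>The irreducible representation indexed by \<open>lam\<close> is determined only up to equivalence: the
  ideals obtained from different tableaux of shape \<open>lam\<close> are isomorphic. Hence the quantifier
  over all tableaux.\<close>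

definition equivalent_to_irrep ::
    "nat \<Rightarrow> nat list \<Rightarrow> nat \<Rightarrow> ((nat \<Rightarrow> nat) \<Rightarrow> 'k::field mat) \<Rightarrow> bool" where
  "equivalent_to_irrep n lam m M \<longleftrightarrow>
     (\<forall>T. is_tableau n lam T \<longrightarrow> equivalent_to_ideal n m M (young_ideal n lam T))"

end

theory Submission
  imports Defs "Jordan_Normal_Form.Determinant"
begin

text \<open>Fix a tableau \<open>T\<close> and let \<open>L = kS\<^sub>n P N\<close>. An element of \<open>L\<close> is a function \<open>y\<close> on the
  symmetric group. Write \<open>\<sigma>\<^sub>k\<close> for the permutation that carries \<open>T\<close> to the \<open>k\<close>-th standard
  tableau. Everything rests on the claim that \<open>y \<mapsto> (y \<sigma>\<^sub>k)\<^sub>k\<close> is a bijection from \<open>L\<close> to the column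
  vectors of length \<open>m\<close>.

  It is injective because \<open>y\<close> can be straightened (\<open>young_mult_eq_0\<close>). Right multiplication by a
  column permutation \<open>b\<close> multiplies the values of \<open>y\<close> by the sign of \<open>b\<close>, and the alternating sum of
  the values over all permutations of a set \<open>Z\<close> of entries vanishes as soon as every column
  permutation brings two entries of \<open>Z\<close> into one row (\<open>young_mult_garnir\<close>). If \<open>p\<close> violates the row
  condition, take for \<open>Z\<close> the entries of one column from the violation downwards together with those
  of the other column from the violation upwards: by pigeonhole this is such a set. The terms of the
  sum either repeat \<open>y p\<close> or are values at permutations of larger weight (the sum of the entries,
  each multiplied by its column number). So a permutation of maximal weight where \<open>y\<close> does not vanish
  is standard up to a column permutation.

  It is surjective because the matrix \<open>A\<close> of the values of the generators \<open>\<sigma>\<^sub>j P N\<close> at the \<open>\<sigma>\<^sub>k\<close>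
  is triangular with ones on the diagonal for the order by weight: a nonzero entry says that
  \<open>\<sigma>\<^sub>k = \<sigma>\<^sub>j a b\<close> with \<open>a\<close> a row and \<open>b\<close> a column permutation; \<open>b\<close> preserves the weight, and \<open>a\<close>
  strictly decreases it unless \<open>a\<close> is the identity (\<open>young_coeff_triangular\<close>).

  Now let \<open>X s\<close> be the matrix of the values of the \<open>s \<sigma>\<^sub>j P N\<close> at the \<open>\<sigma>\<^sub>k\<close>, so that \<open>A\<close> is the matrix
  of the identity, and let \<open>c\<close> be its inverse. The entry \<open>(k, j)\<close> is the coefficient of
  \<open>\<sigma>\<^sub>j\<^sup>-\<^sup>1 s\<^sup>-\<^sup>1 \<sigma>\<^sub>k\<close> in \<open>P N\<close>; it is the sign of \<open>b\<close> if that permutation is a product \<open>a b\<close> as above,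
  which can happen in at most one way, and \<open>0\<close> otherwise. In the coordinates given by evaluation,
  left multiplication by \<open>s\<close> is \<open>X s * c\<close>: \<open>c\<close> converts values to coefficients with respect to the
  generators, and \<open>X s\<close> converts these to the values of the translate. Applied to the columns of
  \<open>X t\<close>, which are the values of elements of \<open>L\<close>, this gives \<open>X (s t) = X s * c * X t\<close>. Finally the
  entries of \<open>X s\<close> depend on the standard tableaux alone and not on \<open>T\<close>
  (\<open>tab_coeff_transport\<close>), so the same matrices serve for all tableaux.\<close>

section \<open>Permutations preserving a labelling, and their weights\<close>

text \<open>For the row or column number as \<open>f\<close> this is the row or column group of a tableau.\<close>

definition level_group :: "nat set \<Rightarrow> (nat \<Rightarrow> nat) \<Rightarrow> (nat \<Rightarrow> nat) set" where
  "level_group V f = {p. p permutes V \<and> (\<forall>v\<in>V. f (p v) = f v)}"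

definition weight :: "nat set \<Rightarrow> (nat \<Rightarrow> nat) \<Rightarrow> (nat \<Rightarrow> nat) \<Rightarrow> nat" where
  "weight V f p = (\<Sum>v\<in>V. f v * p v)"

lemma level_groupD:
  assumes "p \<in> level_group V f"
  shows "p permutes V" and "v \<in> V \<Longrightarrow> f (p v) = f v"
  using assms by (auto simp: level_group_def)

lemma id_level_group: "id \<in> level_group V f"
  by (simp add: level_group_def permutes_id)

lemma comp_level_group:
  assumes "p \<in> level_group V f" "q \<in> level_group V f"
  shows "p \<circ> q \<in> level_group V f"
  using assms by (auto simp: level_group_def permutes_compose permutes_in_image)

lemma inv_level_group:
  assumes "p \<in> level_group V f"
  shows "inv' p \<in> level_group V f"
proof -
  have p: "p permutes V" by (rule level_groupD[OF assms])
  have "f (inv' p v) = f v" if "v \<in> V" for v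
  proof -
    have "inv' p v \<in> V" using that permutes_inv[OF p] by (simp add: permutes_in_image)
    from level_groupD(2)[OF assms this] show ?thesis by (simp add: permutes_inverses[OF p])
  qed
  thus ?thesis using permutes_inv[OF p] by (simp add: level_group_def)
qed

lemma transpose_level_group:
  assumes "u \<in> V" "v \<in> V" "f u = f v"
  shows "transpose u v \<in> level_group V f"
  using assms by (auto simp: level_group_def transpose_def permutes_swap_id)

lemma finite_level_group: "finite V \<Longrightarrow> finite (level_group V f)"
  by (rule finite_subset[OF _ finite_permutations[of V]]) (auto simp: level_group_def)

lemma sum_level_group_mult:
  assumes "c \<in> level_group V f"
  shows "(\<Sum>a\<in>level_group V f. h (a \<circ> c)) = (\<Sum>a\<in>level_group V f. h a)"
proof -
  have c: "c permutes V" by (rule level_groupD[OF assms])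
  show ?thesis
    by (rule sum.reindex_bij_witness[of _ "\<lambda>a. a \<circ> inv' c" "\<lambda>a. a \<circ> c"])
      (use assms in \<open>auto simp: comp_assoc permutes_inv_o[OF c]
        intro: comp_level_group inv_level_group\<close>)
qed

lemma inv_comp_permutes:
  assumes "p permutes V" "q permutes V"
  shows "inv' (p \<circ> q) = inv' q \<circ> inv' p"
  using assms by (intro o_inv_distrib permutes_bij)

lemma sign_comp_permutes:
  assumes "finite V" "p permutes V" "q permutes V"
  shows "sign (p \<circ> q) = sign p * sign q"
  using assms by (intro sign_compose permutes_imp_permutation)

lemma sign_inv_permutes:
  assumes "finite V" "p permutes V"
  shows "sign (inv' p) = sign p"
  using assms by (intro sign_inverse permutes_imp_permutation)

lemma weight_level_group:
  assumes "c \<in> level_group V f"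
  shows "weight V f (p \<circ> c) = weight V f p"
proof -
  have c: "c permutes V" by (rule level_groupD[OF assms])
  have "weight V f (p \<circ> c) = (\<Sum>v\<in>V. f (c v) * p (c v))"
    unfolding weight_def by (rule sum.cong) (simp_all add: level_groupD(2)[OF assms])
  also have "\<dots> = weight V f p"
    unfolding weight_def by (rule sum.permute[OF c, symmetric, unfolded comp_def])
  finally show ?thesis .
qed

lemma weight_transpose_less:
  assumes "finite V" "u \<in> V" "v \<in> V" "f u < f v" "p v < p u"
  shows "weight V f p < weight V f (p \<circ> transpose u v)"
proof -
  let ?W = "V - {u} - {v}"
  have "u \<noteq> v" using assms by auto
  have split: "weight V f q = f u * q u + (f v * q v + (\<Sum>w\<in>?W. f w * q w))" for q
    unfolding weight_def using assms \<open>u \<noteq> v\<close>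
    by (simp add: sum.remove[of V u] sum.remove[of "V - {u}" v])
  have rest: "(\<Sum>w\<in>?W. f w * (p \<circ> transpose u v) w) = (\<Sum>w\<in>?W. f w * p w)"
    by (rule sum.cong) (auto simp: transpose_def)
  obtain a where a: "f v = f u + a" "a > 0" using assms(4) less_imp_add_positive by metis
  obtain b where b: "p u = p v + b" "b > 0" using assms(5) less_imp_add_positive by metis
  have "f u * p u + f v * p v < f u * p v + f v * p u"
    using a b by (simp add: algebra_simps)
  thus ?thesis unfolding split rest by simp
qed

lemma sum_less_exchange:
  fixes p :: "'a \<Rightarrow> nat"
  assumes "finite A" "finite B" "B' \<subseteq> A \<union> B" "card B' = card B" "B' \<noteq> B"
    and "\<And>b. b \<in> B \<Longrightarrow> p b \<le> M" "\<And>a. a \<in> A \<Longrightarrow> M < p a"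
  shows "sum p B < sum p B'"
proof -
  have fB': "finite B'" using assms(1-3) finite_subset by blast
  have c: "card (B' - B) = card (B - B')"
    using card_Int_Diff[OF fB', of B] card_Int_Diff[OF assms(2), of B'] assms(4)
    by (simp add: Int_commute)
  have ne: "B' - B \<noteq> {}"
    using assms(2,4,5) card_subset_eq[of B B'] by blast
  have "sum p (B - B') \<le> card (B' - B) * M"
    unfolding c using sum_bounded_above[of "B - B'" p M] assms(6) by auto
  also have "\<dots> = (\<Sum>b\<in>B' - B. M)" by simp
  also have "\<dots> < sum p (B' - B)"
    by (rule sum_strict_mono) (use fB' ne assms(3,7) in auto)
  finally have "sum p (B - B') < sum p (B' - B)" .
  moreover have "sum p B = sum p (B \<inter> B') + sum p (B - B')"
    by (rule sum.Int_Diff[OF assms(2)])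
  moreover have "sum p B' = sum p (B \<inter> B') + sum p (B' - B)"
    unfolding Int_commute[of B] by (rule sum.Int_Diff[OF fB'])
  ultimately show ?thesis by simp
qed

text \<open>The entries at \<open>B\<close> are smaller than those at \<open>A\<close>, and \<open>B\<close> carries the larger label.
  A permutation that moves \<open>B\<close> replaces some of its entries by larger ones.\<close>

lemma weight_garnir_less:
  assumes "finite V" and sub: "A \<subseteq> V" "B \<subseteq> V" and w: "w permutes (A \<union> B)" and "w ` B \<noteq> B"
    and f: "\<And>a. a \<in> A \<Longrightarrow> f a = j" "\<And>b. b \<in> B \<Longrightarrow> f b = j'" "j < j'"
    and p: "\<And>b. b \<in> B \<Longrightarrow> p b \<le> M" "\<And>a. a \<in> A \<Longrightarrow> M < p a"
  shows "weight V f p < weight V f (p \<circ> w)"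
proof -
  have fin: "finite A" "finite B" using sub assms(1) finite_subset by auto
  have dis: "A \<inter> B = {}" using f by fastforce
  let ?Z = "A \<union> B"
  have split: "weight V f q = (\<Sum>v\<in>V - ?Z. f v * q v) + (j * (\<Sum>v\<in>A. q v) + j' * (\<Sum>v\<in>B. q v))" for q
  proof -
    have "weight V f q = (\<Sum>v\<in>V - ?Z. f v * q v) + (\<Sum>v\<in>?Z. f v * q v)"
      unfolding weight_def using assms(1) sub by (intro sum.subset_diff) auto
    also have "(\<Sum>v\<in>?Z. f v * q v) = (\<Sum>v\<in>A. f v * q v) + (\<Sum>v\<in>B. f v * q v)"
      by (rule sum.union_disjoint[OF fin dis])
    also have "(\<Sum>v\<in>A. f v * q v) = j * (\<Sum>v\<in>A. q v)" using f by (simp add: sum_distrib_left)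
    also have "(\<Sum>v\<in>B. f v * q v) = j' * (\<Sum>v\<in>B. q v)" using f by (simp add: sum_distrib_left)
    finally show ?thesis .
  qed
  have rest: "(\<Sum>v\<in>V - ?Z. f v * (p \<circ> w) v) = (\<Sum>v\<in>V - ?Z. f v * p v)"
    by (rule sum.cong) (use w in \<open>auto simp: permutes_not_in\<close>)
  have tot: "sum (p \<circ> w) A + sum (p \<circ> w) B = sum p A + sum p B"
    using sum.permute[OF w, of p] by (simp only: sum.union_disjoint[OF fin dis])
  have img: "sum (p \<circ> w) B = sum p (w ` B)"
    by (rule sum.reindex[symmetric]) (rule permutes_inj_on[OF w])
  have lt: "sum p B < sum (p \<circ> w) B"
    unfolding img
  proof (rule sum_less_exchange[of A])
    show "w ` B \<subseteq> A \<union> B" using permutes_image[OF w] by blast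
    show "card (w ` B) = card B" by (rule card_image) (rule permutes_inj_on[OF w])
  qed (use fin assms(5) p in auto)
  obtain d where d: "j' = j + d" "d > 0" using f(3) less_imp_add_positive by metis
  have "j * sum p A + j' * sum p B = j * (sum p A + sum p B) + d * sum p B"
    unfolding d by (simp add: algebra_simps)
  also have "\<dots> < j * (sum p A + sum p B) + d * sum (p \<circ> w) B" using lt d by simp
  also have "\<dots> = j * (sum (p \<circ> w) A + sum (p \<circ> w) B) + d * sum (p \<circ> w) B" by (simp only: tot)
  also have "\<dots> = j * sum (p \<circ> w) A + j' * sum (p \<circ> w) B"
    unfolding d by (simp add: algebra_simps)
  finally show ?thesis unfolding split rest by simp
qed

lemma ex_maximizer:
  fixes f :: "'a \<Rightarrow> nat"
  assumes "finite S" "S \<noteq> {}"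
  shows "\<exists>x\<in>S. \<forall>y\<in>S. f y \<le> f x"
proof -
  have "Max (f ` S) \<in> f ` S" using assms by simp
  then obtain x where "x \<in> S" "f x = Max (f ` S)" by auto
  thus ?thesis using assms by (metis Max_ge finite_imageI imageI)
qed

section \<open>Straightening in a Young diagram\<close>

text \<open>A Young diagram, given through the set \<open>V\<close> of entries of one fixed tableau: each entry stands for
  its cell, with row \<open>rw\<close> and column \<open>cl\<close>. The other tableaux are then permutations of \<open>V\<close>. That the
  rows are left-justified and of weakly decreasing length is expressed by closure of the set
  of cells towards the corner.\<close>

locale young_shape =
  fixes V :: "nat set" and rw cl :: "nat \<Rightarrow> nat"
  assumes fin: "finite V"
    and cell_inj: "\<lbrakk>u \<in> V; v \<in> V; rw u = rw v; cl u = cl v\<rbrakk> \<Longrightarrow> u = v"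
    and down_closed: "\<lbrakk>v \<in> V; r \<le> rw v; c \<le> cl v\<rbrakk> \<Longrightarrow> \<exists>u\<in>V. rw u = r \<and> cl u = c"
begin

abbreviation R where "R \<equiv> level_group V rw"
abbreviation C where "C \<equiv> level_group V cl"

definition standard :: "(nat \<Rightarrow> nat) \<Rightarrow> bool" where
  "standard p \<longleftrightarrow>
     (\<forall>u\<in>V. \<forall>v\<in>V. rw u = rw v \<and> cl u < cl v \<longrightarrow> p u < p v) \<and>
     (\<forall>u\<in>V. \<forall>v\<in>V. cl u = cl v \<and> rw u < rw v \<longrightarrow> p u < p v)"

text \<open>The value at \<open>p\<close> of the product of \<open>x\<close> with the row sum and the signed column sum.\<close>

definition young_mult :: "((nat \<Rightarrow> nat) \<Rightarrow> 'k::field_char_0) \<Rightarrow> (nat \<Rightarrow> nat) \<Rightarrow> 'k" where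
  "young_mult x p = (\<Sum>b\<in>C. of_int (sign b) * (\<Sum>a\<in>R. x (p \<circ> inv' b \<circ> inv' a)))"

lemma young_mult_column:
  assumes c: "c \<in> C"
  shows "young_mult x (p \<circ> c) = of_int (sign c) * young_mult x p"
proof -
  note pc = level_groupD(1)[OF c]
  have "young_mult x (p \<circ> c)
    = (\<Sum>b\<in>C. of_int (sign (b \<circ> c)) * (\<Sum>a\<in>R. x (p \<circ> c \<circ> inv' (b \<circ> c) \<circ> inv' a)))"
    unfolding young_mult_def
    by (rule sum_level_group_mult[OF c, symmetric])
  also have "\<dots> = (\<Sum>b\<in>C. of_int (sign c) * (of_int (sign b) * (\<Sum>a\<in>R. x (p \<circ> inv' b \<circ> inv' a))))"
  proof (rule sum.cong[OF refl])
    fix b assume "b \<in> C"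
    note pb = level_groupD(1)[OF this]
    have "p \<circ> c \<circ> inv' (b \<circ> c) = p \<circ> (c \<circ> inv' c) \<circ> inv' b"
      by (simp add: inv_comp_permutes[OF pb pc] comp_assoc)
    hence "p \<circ> c \<circ> inv' (b \<circ> c) = p \<circ> inv' b" by (simp add: permutes_inv_o[OF pc])
    moreover have "sign (b \<circ> c) = sign c * sign b"
      by (simp add: sign_comp_permutes[OF fin pb pc])
    ultimately show "of_int (sign (b \<circ> c)) * (\<Sum>a\<in>R. x (p \<circ> c \<circ> inv' (b \<circ> c) \<circ> inv' a))
      = of_int (sign c) * (of_int (sign b) * (\<Sum>a\<in>R. x (p \<circ> inv' b \<circ> inv' a)))"
      by simp
  qed
  finally show ?thesis by (simp add: young_mult_def sum_distrib_left)
qed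

lemma row_average_invariant:
  assumes c: "c \<in> R"
  shows "(\<Sum>a\<in>R. x (g \<circ> c \<circ> inv' a)) = (\<Sum>a\<in>R. x (g \<circ> inv' a))"
proof -
  note pc = level_groupD(1)[OF c]
  have "(\<Sum>a\<in>R. x (g \<circ> c \<circ> inv' a)) = (\<Sum>a\<in>R. x (g \<circ> c \<circ> inv' (a \<circ> c)))"
    by (rule sum_level_group_mult[OF c, symmetric])
  also have "\<dots> = (\<Sum>a\<in>R. x (g \<circ> inv' a))"
  proof (rule sum.cong[OF refl])
    fix a assume "a \<in> R"
    note pa = level_groupD(1)[OF this]
    have "g \<circ> c \<circ> inv' (a \<circ> c) = g \<circ> (c \<circ> inv' c) \<circ> inv' a"
      by (simp add: inv_comp_permutes[OF pa pc] comp_assoc)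
    thus "x (g \<circ> c \<circ> inv' (a \<circ> c)) = x (g \<circ> inv' a)" by (simp add: permutes_inv_o[OF pc])
  qed
  finally show ?thesis .
qed

text \<open>If \<open>b\<close> brings \<open>u\<close> and \<open>v\<close> into one row, then the transposition of \<open>u\<close> and \<open>v\<close>, moved past \<open>b\<close>,
  is absorbed by the row sum. So, for each \<open>b\<close> separately, the terms for \<open>w\<close> and for \<open>w\<close> composed with
  this transposition cancel.\<close>

lemma young_mult_garnir:
  fixes x :: "(nat \<Rightarrow> nat) \<Rightarrow> 'k::field_char_0"
  assumes Z: "Z \<subseteq> V" and ni: "\<And>b. b \<in> C \<Longrightarrow> \<not> inj_on (rw \<circ> b) Z"
  shows "(\<Sum>w | w permutes Z. of_int (sign w) * young_mult x (p \<circ> w)) = 0"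
proof -
  have fZ: "finite Z" using Z fin finite_subset by blast
  define r where "r g = (\<Sum>a\<in>R. x (g \<circ> inv' a))" for g
  have zero: "(\<Sum>w | w permutes Z. of_int (sign w) * r (p \<circ> w \<circ> inv' b)) = 0" (is "?S = 0")
    if b: "b \<in> C" for b
  proof -
    note pb = level_groupD(1)[OF b]
    from ni[OF b] obtain u v where uv: "u \<in> Z" "v \<in> Z" "u \<noteq> v" "rw (b u) = rw (b v)"
      by (auto simp: inj_on_def)
    let ?t = "transpose u v"
    have t: "?t permutes Z" using uv by (simp add: permutes_swap_id)
    have bt: "transpose (b u) (b v) \<in> R"
      using uv Z pb by (intro transpose_level_group) (auto simp: permutes_in_image)
    have "?S = (\<Sum>w | w permutes Z. of_int (sign (w \<circ> ?t)) * r (p \<circ> (w \<circ> ?t) \<circ> inv' b))"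
      by (rule sum_permutations_compose_right[OF t])
    also have "\<dots> = (\<Sum>w | w permutes Z. - (of_int (sign w) * r (p \<circ> w \<circ> inv' b)))"
    proof (rule sum.cong[OF refl])
      fix w assume "w \<in> {w. w permutes Z}"
      hence w: "w permutes Z" by simp
      have "?t \<circ> inv' b = inv' b \<circ> transpose (b u) (b v)"
      proof
        fix i
        show "(?t \<circ> inv' b) i = (inv' b \<circ> transpose (b u) (b v)) i"
          by (auto simp: transpose_def permutes_inverses[OF pb] permutes_inv_eq[OF pb])
      qed
      hence "p \<circ> (w \<circ> ?t) \<circ> inv' b = p \<circ> w \<circ> inv' b \<circ> transpose (b u) (b v)"
        by (simp add: comp_assoc)
      hence "r (p \<circ> (w \<circ> ?t) \<circ> inv' b) = r (p \<circ> w \<circ> inv' b)"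
        unfolding r_def using row_average_invariant[OF bt] by simp
      moreover have "sign (w \<circ> ?t) = - sign w"
        using uv by (simp add: sign_comp_permutes[OF fZ w t] sign_swap_id)
      ultimately show "of_int (sign (w \<circ> ?t)) * r (p \<circ> (w \<circ> ?t) \<circ> inv' b)
        = - (of_int (sign w) * r (p \<circ> w \<circ> inv' b))" by simp
    qed
    also have "\<dots> = - ?S" by (simp add: sum_negf)
    finally show ?thesis by simp
  qed
  have "(\<Sum>w | w permutes Z. of_int (sign w) * young_mult x (p \<circ> w))
    = (\<Sum>w | w permutes Z. \<Sum>b\<in>C. of_int (sign b) * (of_int (sign w) * r (p \<circ> w \<circ> inv' b)))"
    by (simp add: young_mult_def r_def sum_distrib_left mult.left_commute)
  also have "\<dots> = (\<Sum>b\<in>C. of_int (sign b) *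
      (\<Sum>w | w permutes Z. of_int (sign w) * r (p \<circ> w \<circ> inv' b)))"
    by (subst sum.swap) (simp add: sum_distrib_left)
  also have "\<dots> = 0" by (simp add: zero)
  finally show ?thesis .
qed

text \<open>With \<open>h\<close> cells in the left column, \<open>A\<close> and \<open>B\<close> have together \<open>h + 1\<close> elements, because both
  contain one in the row of \<open>u\<close>. A column permutation keeps them in two columns that meet only \<open>h\<close> rows.\<close>

lemma garnir_pigeonhole:
  assumes u: "u \<in> V" "v \<in> V" "rw u = rw v" "cl u < cl v"
    and A: "A = {a \<in> V. cl a = cl u \<and> rw u \<le> rw a}"
    and B: "B = {b \<in> V. cl b = cl v \<and> rw b \<le> rw u}"
    and b: "b \<in> C"
  shows "\<not> inj_on (rw \<circ> b) (A \<union> B)"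
proof
  assume inj: "inj_on (rw \<circ> b) (A \<union> B)"
  \<comment> \<open>the rows that the left column meets; the right column meets no others\<close>
  define H where "H = rw ` {a \<in> V. cl a = cl u}"
  have fH: "finite H" using fin by (simp add: H_def)
  have H1: "rw a \<in> H" if "a \<in> V" "cl a = cl u \<or> cl a = cl v" for a
  proof -
    have "cl u \<le> cl a" using that u by auto
    from down_closed[OF that(1) le_refl this]
    obtain w where "w \<in> V" "rw w = rw a" "cl w = cl u" by blast
    thus ?thesis unfolding H_def by (intro image_eqI[of _ _ w]) auto
  qed
  have "(rw \<circ> b) ` (A \<union> B) \<subseteq> H"
    using level_groupD[OF b] by (auto intro!: H1 simp: A B permutes_in_image)
  hence "card (A \<union> B) \<le> card H" using inj fH by (metis card_inj_on_le)
  moreover have "card (A \<union> B) = card A + card B"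
    using fin u by (intro card_Un_disjoint) (auto simp: A B)
  moreover have "card A = card {r \<in> H. rw u \<le> r}"
  proof -
    have "inj_on rw A" by (rule inj_onI) (auto simp: A intro: cell_inj)
    moreover have "rw ` A = {r \<in> H. rw u \<le> r}" by (auto simp: A H_def)
    ultimately show ?thesis by (metis card_image)
  qed
  moreover have "card B = card {r \<in> H. r \<le> rw u}"
  proof -
    have "inj_on rw B" by (rule inj_onI) (auto simp: B intro: cell_inj)
    moreover have "rw ` B = {r \<in> H. r \<le> rw u}"
    proof
      show "rw ` B \<subseteq> {r \<in> H. r \<le> rw u}" by (auto simp: B intro: H1)
      show "{r \<in> H. r \<le> rw u} \<subseteq> rw ` B"
      proof
        fix r assume "r \<in> {r \<in> H. r \<le> rw u}"
        hence "r \<le> rw v" "r \<le> rw u" using u by auto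
        from down_closed[OF u(2) this(1) le_refl] this(2) show "r \<in> rw ` B" by (force simp: B)
      qed
    qed
    ultimately show ?thesis by (metis card_image)
  qed
  moreover have "card {r \<in> H. rw u \<le> r} + card {r \<in> H. r \<le> rw u}
      = card ({r \<in> H. rw u \<le> r} \<union> {r \<in> H. r \<le> rw u})
      + card ({r \<in> H. rw u \<le> r} \<inter> {r \<in> H. r \<le> rw u})"
    using fH by (intro card_Un_Int) auto
  moreover have "{r \<in> H. rw u \<le> r} \<union> {r \<in> H. r \<le> rw u} = H" by auto
  moreover have "{r \<in> H. rw u \<le> r} \<inter> {r \<in> H. r \<le> rw u} = {rw u}"
    using H1[OF u(1)] by auto
  ultimately show False by simp
qed

text \<open>Straightening: among the permutations where the value is nonzero, one with the largest column weight
  and then the largest row weight must be standard. The row weight breaks the tie within a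
  column class and forces the columns to increase; the column weight then rules out a descent in a row,
  through the alternating sum above.\<close>

lemma young_mult_eq_0:
  fixes x :: "(nat \<Rightarrow> nat) \<Rightarrow> 'k::field_char_0"
  assumes std: "\<And>p. p permutes V \<Longrightarrow> standard p \<Longrightarrow> young_mult x p = 0"
    and q: "q permutes V"
  shows "young_mult x q = 0"
proof (rule ccontr)
  assume nz: "young_mult x q \<noteq> 0"
  define S where "S = {p. p permutes V \<and> young_mult x p \<noteq> 0}"
  have "finite S" by (rule finite_subset[OF _ finite_permutations[OF fin]]) (auto simp: S_def)
  moreover have "S \<noteq> {}" using q nz by (auto simp: S_def)
  ultimately obtain p1 where p1: "p1 \<in> S" "\<forall>p'\<in>S. weight V cl p' \<le> weight V cl p1"
    using ex_maximizer[of S "weight V cl"] by blast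
  define S1 where "S1 = {p \<in> S. weight V cl p = weight V cl p1}"
  have "finite S1" "S1 \<noteq> {}" using \<open>finite S\<close> p1 by (auto simp: S1_def)
  then obtain p where p: "p \<in> S1" "\<forall>p'\<in>S1. weight V rw p' \<le> weight V rw p"
    using ex_maximizer[of S1 "weight V rw"] by blast
  have pp: "p permutes V" and pnz: "young_mult x p \<noteq> 0" and pS: "p \<in> S"
    and pw: "weight V cl p = weight V cl p1"
    using p(1) by (auto simp: S1_def S_def)
  have neq: "p u \<noteq> p v" if "u \<noteq> v" for u v
    using that permutes_inj[OF pp] by (auto simp: inj_on_def)
  have col: "p u < p v" if uv: "u \<in> V" "v \<in> V" "cl u = cl v" "rw u < rw v" for u v
  proof (rule ccontr)
    assume "\<not> p u < p v"
    hence lt: "p v < p u" using neq[of u v] uv by fastforce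
    let ?t = "transpose u v"
    have t: "?t \<in> C" using uv by (intro transpose_level_group)
    have "u \<noteq> v" using uv by auto
    hence "young_mult x (p \<circ> ?t) = - young_mult x p"
      unfolding young_mult_column[OF t] by (simp add: sign_swap_id)
    moreover have "p \<circ> ?t permutes V"
      using permutes_compose[OF level_groupD(1)[OF t] pp] .
    ultimately have "p \<circ> ?t \<in> S1"
      using pnz pw by (simp add: S1_def S_def weight_level_group[OF t])
    moreover have "weight V rw p < weight V rw (p \<circ> ?t)"
      by (rule weight_transpose_less[where f = rw and p = p, OF fin uv(1,2,4) lt])
    ultimately show False using p(2) by fastforce
  qed
  have "\<not> standard p" using std[OF pp] pnz by blast
  then obtain u v where uv: "u \<in> V" "v \<in> V" "rw u = rw v" "cl u < cl v" and "\<not> p u < p v"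
    using col unfolding standard_def by blast
  hence lt: "p v < p u" using neq[of u v] by fastforce
  define A where "A = {a \<in> V. cl a = cl u \<and> rw u \<le> rw a}"
  define B where "B = {b \<in> V. cl b = cl v \<and> rw b \<le> rw u}"
  let ?Z = "A \<union> B"
  have ZV: "A \<subseteq> V" "B \<subseteq> V" "?Z \<subseteq> V" by (auto simp: A_def B_def)
  have fZ: "finite ?Z" using ZV fin finite_subset by blast
  have pA: "p v < p a" if "a \<in> A" for a
  proof (cases "a = u")
    case False
    hence "rw u < rw a" using that cell_inj[of a u] uv by (force simp: A_def)
    thus ?thesis using col[of u a] that uv lt by (auto simp: A_def)
  qed (simp add: lt)
  have pB: "p b \<le> p v" if "b \<in> B" for b
  proof (cases "b = v")
    case False
    hence "rw b < rw v" using that cell_inj[of b v] uv by (force simp: B_def)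
    thus ?thesis using col[of b v] that uv by (auto simp: B_def)
  qed simp
  let ?W = "{w. w permutes ?Z}"
  let ?K = "{w \<in> ?W. w ` B = B}"
  have fW: "finite ?W" using fZ by (rule finite_permutations)
  \<comment> \<open>permutations in the column group reproduce the value at \<open>p\<close>; the others raise the weight\<close>
  have summand: "of_int (sign w) * young_mult x (p \<circ> w) = (if w ` B = B then young_mult x p else 0)"
    if w: "w permutes ?Z" for w
  proof (cases "w ` B = B")
    case True
    have dis: "A \<inter> B = {}" using uv by (auto simp: A_def B_def)
    have "w ` ?Z = ?Z" by (rule permutes_image[OF w])
    moreover have "w ` A \<inter> w ` B = {}"
      using dis permutes_inj[OF w] by (metis image_Int image_empty)
    ultimately have wA: "w ` A \<subseteq> A" unfolding True image_Un by blast
    have "cl (w z) = cl z" if "z \<in> V" for z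
    proof (cases "z \<in> ?Z")
      case True
      moreover have "w z \<in> A" if "z \<in> A" using wA that by blast
      moreover have "w z \<in> B" if "z \<in> B" using \<open>w ` B = B\<close> that by blast
      ultimately consider "z \<in> A" "w z \<in> A" | "z \<in> B" "w z \<in> B" by blast
      thus ?thesis by cases (auto simp: A_def B_def)
    qed (simp add: permutes_not_in[OF w])
    hence "w \<in> C" using permutes_subset[OF w ZV(3)] by (simp add: level_group_def)
    hence "of_int (sign w) * young_mult x (p \<circ> w)
        = of_int (sign w * sign w) * young_mult x p"
      unfolding young_mult_column[OF \<open>w \<in> C\<close>] of_int_mult by (simp only: mult.assoc)
    thus ?thesis using True by simp
  next
    case False
    have "weight V cl p < weight V cl (p \<circ> w)"
      by (rule weight_garnir_less[OF fin ZV(1,2) w False, of cl "cl u" "cl v" p "p v"])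
        (use pA pB uv in \<open>auto simp: A_def B_def\<close>)
    hence "p \<circ> w \<notin> S" using p1(2) pw by fastforce
    moreover have "p \<circ> w permutes V"
      using permutes_compose[OF permutes_subset[OF w ZV(3)] pp] .
    ultimately show ?thesis using False by (simp add: S_def)
  qed
  \<comment> \<open>characteristic 0 enters here: the value at \<open>p\<close> is counted a positive number of times\<close>
  have "0 = (\<Sum>w\<in>?W. of_int (sign w) * young_mult x (p \<circ> w))"
    by (rule young_mult_garnir[OF ZV(3), symmetric])
      (rule garnir_pigeonhole[OF uv A_def B_def])
  also have "\<dots> = (\<Sum>w\<in>?W. if w ` B = B then young_mult x p else 0)"
    by (rule sum.cong) (simp_all add: summand)
  also have "\<dots> = of_nat (card ?K) * young_mult x p"
    using fW by (simp add: sum.If_cases Int_def)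
  finally have "card ?K = 0" using pnz by simp
  moreover have "finite ?K" by (rule finite_subset[OF _ fW]) blast
  moreover have "id \<in> ?K" by (simp add: permutes_id)
  ultimately show False using card_0_eq[of ?K] by blast
qed

section \<open>Triangularity of the symmetrizer on standard fillings\<close>

text \<open>The coefficient of \<open>h\<close> in the product of the row sum and the signed column sum.\<close>

definition young_coeff :: "(nat \<Rightarrow> nat) \<Rightarrow> int" where
  "young_coeff h = (\<Sum>b\<in>C. if h \<circ> inv' b \<in> R then sign b else 0)"

lemma row_column_trivial:
  assumes "g \<in> R" "g \<in> C"
  shows "g = id"
proof
  fix v
  show "g v = id v"
  proof (cases "v \<in> V")
    case True
    hence "g v \<in> V" "rw (g v) = rw v" "cl (g v) = cl v"
      using level_groupD[OF assms(1)] level_groupD(2)[OF assms(2)]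
      by (auto simp: permutes_in_image)
    with True show ?thesis by (simp add: cell_inj)
  qed (use level_groupD(1)[OF assms(1)] in \<open>auto simp: permutes_not_in\<close>)
qed

text \<open>A row permutation that is also a column permutation is the identity, so the factorization
  is unique and only one summand survives.\<close>

lemma young_coeff_prod:
  assumes a: "a \<in> R" and b: "b \<in> C"
  shows "young_coeff (a \<circ> b) = sign b"
proof -
  note pb = level_groupD(1)[OF b] and pa = level_groupD(1)[OF a]
  have "a \<circ> b \<circ> inv' d \<in> R \<longleftrightarrow> d = b" if d: "d \<in> C" for d
  proof
    note pd = level_groupD(1)[OF d]
    assume "a \<circ> b \<circ> inv' d \<in> R"
    hence "inv' a \<circ> (a \<circ> b \<circ> inv' d) \<in> R"
      by (rule comp_level_group[OF inv_level_group[OF a]])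
    moreover have "inv' a \<circ> (a \<circ> b \<circ> inv' d) = (inv' a \<circ> a) \<circ> (b \<circ> inv' d)" by (simp add: comp_assoc)
    ultimately have "b \<circ> inv' d \<in> R" by (simp add: permutes_inv_o[OF pa])
    moreover have "b \<circ> inv' d \<in> C" using b d by (intro comp_level_group inv_level_group)
    ultimately have "b \<circ> inv' d = id" by (rule row_column_trivial)
    hence "b \<circ> (inv' d \<circ> d) = d" by (metis comp_assoc id_comp)
    thus "d = b" by (simp add: permutes_inv_o[OF pd])
  next
    assume "d = b"
    thus "a \<circ> b \<circ> inv' d \<in> R" using a by (simp add: comp_assoc permutes_inv_o[OF pb])
  qed
  hence "young_coeff (a \<circ> b) = (\<Sum>d\<in>C. if d = b then sign d else 0)"
    unfolding young_coeff_def by (intro sum.cong) simp_all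
  thus ?thesis using b finite_level_group[OF fin] by simp
qed

lemma young_coeff_nonzero:
  assumes "young_coeff h \<noteq> 0"
  obtains a b where "a \<in> R" "b \<in> C" "h = a \<circ> b"
proof -
  have "\<exists>b\<in>C. h \<circ> inv' b \<in> R"
    by (rule ccontr) (use assms in \<open>simp add: young_coeff_def\<close>)
  then obtain b where b: "b \<in> C" "h \<circ> inv' b \<in> R" by blast
  have "h = (h \<circ> inv' b) \<circ> b" by (simp add: comp_assoc permutes_inv_o[OF level_groupD(1)[OF b(1)]])
  from that[OF b(2,1) this] show thesis .
qed

lemma young_coeff_range: "young_coeff h \<in> {-1, 0, 1}"
proof (cases "young_coeff h = 0")
  case False
  then obtain a b where "a \<in> R" "b \<in> C" "h = a \<circ> b" by (rule young_coeff_nonzero)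
  thus ?thesis by (cases b rule: sign_cases) (auto simp: young_coeff_prod)
qed simp

lemma young_coeff_id: "young_coeff id = 1"
  using young_coeff_prod[OF id_level_group id_level_group] by simp

text \<open>Without an inversion, \<open>a\<close> would be increasing on each row. As the columns of a row are numbered
  without gaps, no entry could then move to the left, and hence none could move at all.\<close>

lemma row_permutation_inversion:
  assumes a: "a \<in> R" and "a \<noteq> id"
  obtains u v where "u \<in> V" "v \<in> V" "rw u = rw v" "cl u < cl v" "cl (a v) < cl (a u)"
proof (rule ccontr)
  assume neg: "\<not> thesis"
  note inversion = that
  note pa = level_groupD(1)[OF a]
  have mono: "cl (a u) < cl (a v)" if uv: "u \<in> V" "v \<in> V" "rw u = rw v" "cl u < cl v" for u v
  proof -
    have "a u \<noteq> a v" using uv permutes_inj[OF pa] by (auto simp: inj_on_def)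
    moreover have "rw (a u) = rw (a v)" using uv level_groupD(2)[OF a] by simp
    ultimately have "cl (a u) \<noteq> cl (a v)"
      using cell_inj uv by (metis permutes_in_image[OF pa])
    moreover have "\<not> cl (a v) < cl (a u)" using neg inversion[OF uv] by blast
    ultimately show ?thesis by simp
  qed
  have ge: "cl v \<le> cl (a v)" if "v \<in> V" for v
    using that
  proof (induction "cl v" arbitrary: v)
    case (Suc c)
    obtain u where u: "u \<in> V" "rw u = rw v" "cl u = c"
      using down_closed[OF Suc.prems le_refl, of c] Suc.hyps(2) by auto
    have "c \<le> cl (a u)" using Suc.hyps(1)[of u] u by simp
    moreover have "cl (a u) < cl (a v)" using u Suc by (intro mono) auto
    ultimately show ?case using Suc.hyps(2) by simp
  qed simp
  have "(\<Sum>v\<in>V. cl (a v)) = (\<Sum>v\<in>V. cl v)"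
    using sum.permute[OF pa, of cl] by (simp add: comp_def)
  hence "\<not> (\<exists>v\<in>V. cl v < cl (a v))"
    using sum_strict_mono_ex1[OF fin, of cl "\<lambda>v. cl (a v)"] ge by auto
  hence "cl (a v) = cl v" if "v \<in> V" for v using ge[OF that] that by force
  hence "a \<in> C" using pa by (simp add: level_group_def)
  with a have "a = id" by (rule row_column_trivial)
  with \<open>a \<noteq> id\<close> show False ..
qed

text \<open>A form of the rearrangement inequality. An inversion of \<open>a\<close> is a descent of \<open>p \<circ> a\<close> in a row, and
  exchanging the two entries raises the weight; hence only the identity can be a maximizer.\<close>

lemma weight_row_permutation_less:
  assumes p: "standard p" and a: "a \<in> R" "a \<noteq> id"
  shows "weight V cl (p \<circ> a) < weight V cl p"
proof -
  have improve: "\<exists>a'\<in>R. weight V cl (p \<circ> a) < weight V cl (p \<circ> a')" if a: "a \<in> R" "a \<noteq> id" for a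
  proof -
    obtain u v where uv: "u \<in> V" "v \<in> V" "rw u = rw v" "cl u < cl v" "cl (a v) < cl (a u)"
      using row_permutation_inversion[OF a] .
    have "p (a v) < p (a u)"
      using p uv level_groupD[OF a(1)] unfolding standard_def by (metis permutes_in_image)
    hence "weight V cl (p \<circ> a) < weight V cl (p \<circ> a \<circ> transpose u v)"
      using uv by (intro weight_transpose_less[OF fin]) auto
    moreover have "a \<circ> transpose u v \<in> R"
      using uv by (intro comp_level_group a transpose_level_group)
    ultimately show ?thesis by (metis comp_assoc)
  qed
  obtain m where m: "m \<in> R" "\<forall>a'\<in>R. weight V cl (p \<circ> a') \<le> weight V cl (p \<circ> m)"
    using ex_maximizer[OF finite_level_group[OF fin], of rw "\<lambda>a. weight V cl (p \<circ> a)"]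
      id_level_group by blast
  have "m = id" using improve[OF m(1)] m(2) by (meson not_le)
  with improve[OF a] m(2) show ?thesis by fastforce
qed

lemma transposed_shape: "young_shape V cl rw"
proof
  fix v r c assume "v \<in> V" "r \<le> cl v" "c \<le> rw v"
  from down_closed[OF this(1,3,2)] show "\<exists>u\<in>V. cl u = r \<and> rw u = c" by blast
qed (use fin cell_inj in auto)

text \<open>A nonzero coefficient means \<open>q = p \<circ> a \<circ> b\<close>. The column permutation \<open>b\<close> preserves the weight,
  so the hypothesis on weights forces \<open>a\<close> to be the identity. Two standard permutations that differ by
  a column permutation are equal, since their columns are sorted.\<close>

lemma young_coeff_triangular:
  assumes p: "p permutes V" "standard p" and q: "q permutes V" "standard q"
    and nz: "young_coeff (inv' p \<circ> q) \<noteq> 0" and le: "weight V cl p \<le> weight V cl q"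
  shows "p = q"
proof -
  from nz obtain a b where ab: "a \<in> R" "b \<in> C" "inv' p \<circ> q = a \<circ> b" by (rule young_coeff_nonzero)
  note pb = level_groupD(1)[OF ab(2)]
  have "p \<circ> (inv' p \<circ> q) = q"
    by (metis comp_assoc id_comp permutes_inv_o(1)[OF p(1)])
  hence pab: "q = p \<circ> a \<circ> b" unfolding ab(3) by (simp add: comp_assoc)
  hence "weight V cl q = weight V cl (p \<circ> a)" using weight_level_group[OF ab(2)] by simp
  with le weight_row_permutation_less[OF p(2) ab(1)] have "a = id" by fastforce
  hence qpb: "q = p \<circ> b" using pab by simp
  have "b = id"
  proof (rule ccontr)
    assume "b \<noteq> id"
    then obtain u v where uv: "u \<in> V" "v \<in> V" "cl u = cl v" "rw u < rw v" "rw (b v) < rw (b u)"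
      using young_shape.row_permutation_inversion[OF transposed_shape ab(2)] by blast
    have "p (b v) < p (b u)"
      using p(2) uv level_groupD[OF ab(2)] unfolding standard_def by (metis permutes_in_image)
    moreover have "q u < q v" using q(2) uv unfolding standard_def by blast
    ultimately show False by (simp add: qpb)
  qed
  with qpb show ?thesis by simp
qed

end

section \<open>From tableaux to labellings\<close>

definition entry_row :: "nat list \<Rightarrow> (nat \<times> nat \<Rightarrow> nat) \<Rightarrow> nat \<Rightarrow> nat" where
  "entry_row lam T v = fst (inv_into (diagram lam) T v)"

definition entry_col :: "nat list \<Rightarrow> (nat \<times> nat \<Rightarrow> nat) \<Rightarrow> nat \<Rightarrow> nat" where
  "entry_col lam T v = snd (inv_into (diagram lam) T v)"

lemma diagram_Sigma: "diagram lam = (SIGMA i:{..<length lam}. {..<lam ! i})"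
  by (auto simp: diagram_def)

lemma finite_diagram: "finite (diagram lam)"
  by (simp add: diagram_Sigma)

lemma card_diagram: "is_partition n lam \<Longrightarrow> card (diagram lam) = n"
  by (simp add: diagram_Sigma is_partition_def sum_list_sum_nth atLeast0LessThan)

lemma diagram_down_closed:
  assumes "is_partition n lam" "(i, j) \<in> diagram lam" "i' \<le> i" "j' \<le> j"
  shows "(i', j') \<in> diagram lam"
proof -
  have "lam ! i \<le> lam ! i'"
  proof (cases "i' = i")
    case False
    thus ?thesis using assms unfolding is_partition_def diagram_def
      by (auto simp: sorted_wrt_iff_nth_less)
  qed simp
  thus ?thesis using assms(2-4) by (auto simp: diagram_def)
qed

lemma entry_row_tableau: "is_tableau n lam T \<Longrightarrow> (i, j) \<in> diagram lam \<Longrightarrow> entry_row lam T (T (i, j)) = i"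
  by (simp add: is_tableau_def entry_row_def bij_betw_def)

lemma entry_col_tableau: "is_tableau n lam T \<Longrightarrow> (i, j) \<in> diagram lam \<Longrightarrow> entry_col lam T (T (i, j)) = j"
  by (simp add: is_tableau_def entry_col_def bij_betw_def)

lemma tableau_in: "is_tableau n lam T \<Longrightarrow> x \<in> diagram lam \<Longrightarrow> T x \<in> {1..n}"
  unfolding is_tableau_def by (metis bij_betwE)

lemma tableau_entryE:
  assumes "is_tableau n lam T" "v \<in> {1..n}"
  obtains i j where "(i, j) \<in> diagram lam" "v = T (i, j)"
  using assms unfolding is_tableau_def bij_betw_def by (metis imageE surj_pair)

lemma tableau_shape:
  assumes lam: "is_partition n lam" and T: "is_tableau n lam T"
  shows "young_shape {1..n} (entry_row lam T) (entry_col lam T)"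
proof
  fix u v assume uv: "u \<in> {1..n}" "v \<in> {1..n}" "entry_row lam T u = entry_row lam T v"
    "entry_col lam T u = entry_col lam T v"
  obtain i j where u: "(i, j) \<in> diagram lam" "u = T (i, j)" using tableau_entryE[OF T uv(1)] .
  obtain i' j' where v: "(i', j') \<in> diagram lam" "v = T (i', j')" using tableau_entryE[OF T uv(2)] .
  show "u = v" using uv(3,4) u v
    by (simp add: entry_row_tableau[OF T] entry_col_tableau[OF T])
next
  fix v r c assume v: "v \<in> {1..n}" "r \<le> entry_row lam T v" "c \<le> entry_col lam T v"
  obtain i j where ij: "(i, j) \<in> diagram lam" "v = T (i, j)" using tableau_entryE[OF T v(1)] .
  have "(r, c) \<in> diagram lam"
    using diagram_down_closed[OF lam ij(1)] v(2,3) ij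
    by (simp add: entry_row_tableau[OF T] entry_col_tableau[OF T])
  thus "\<exists>u\<in>{1..n}. entry_row lam T u = r \<and> entry_col lam T u = c"
    using tableau_in[OF T] entry_row_tableau[OF T] entry_col_tableau[OF T] by blast
qed simp

text \<open>Row and column groups are given as stabilizers of sets of entries; the labelling turns this
  into a pointwise condition.\<close>

lemma fibre_stabilizer_eq_level_group:
  assumes "finite V"
  shows "{p. p permutes V \<and> (\<forall>i. p ` {v \<in> V. f v = i} = {v \<in> V. f v = i})} = level_group V f"
proof (intro Set.set_eqI iffI)
  fix p assume "p \<in> {p. p permutes V \<and> (\<forall>i. p ` {v \<in> V. f v = i} = {v \<in> V. f v = i})}"
  thus "p \<in> level_group V f" unfolding level_group_def by blast
next
  fix p assume p: "p \<in> level_group V f"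
  have "p ` {v \<in> V. f v = i} = {v \<in> V. f v = i}" for i
  proof (rule endo_inj_surj)
    show "p ` {v \<in> V. f v = i} \<subseteq> {v \<in> V. f v = i}"
      using level_groupD[OF p] by (auto simp: permutes_in_image)
  qed (use assms permutes_inj_on[OF level_groupD(1)[OF p]] in auto)
  thus "p \<in> {p. p permutes V \<and> (\<forall>i. p ` {v \<in> V. f v = i} = {v \<in> V. f v = i})}"
    using level_groupD(1)[OF p] by simp
qed

lemma row_group_eq:
  assumes T: "is_tableau n lam T"
  shows "row_group n lam T = level_group {1..n} (entry_row lam T)"
proof -
  have "row_entries lam T i = {v \<in> {1..n}. entry_row lam T v = i}" for i
  proof
    show "row_entries lam T i \<subseteq> {v \<in> {1..n}. entry_row lam T v = i}"
      unfolding row_entries_def using tableau_in[OF T] entry_row_tableau[OF T] by blast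
    show "{v \<in> {1..n}. entry_row lam T v = i} \<subseteq> row_entries lam T i"
    proof
      fix v assume "v \<in> {v \<in> {1..n}. entry_row lam T v = i}"
      hence v: "v \<in> {1..n}" "entry_row lam T v = i" by auto
      obtain r c where rc: "(r, c) \<in> diagram lam" "v = T (r, c)" using tableau_entryE[OF T v(1)] .
      moreover have "r = i" using v(2) rc by (simp add: entry_row_tableau[OF T])
      ultimately show "v \<in> row_entries lam T i" unfolding row_entries_def by blast
    qed
  qed
  thus ?thesis
    by (simp add: row_group_def sym_group_def fibre_stabilizer_eq_level_group[symmetric])
qed

lemma column_group_eq:
  assumes T: "is_tableau n lam T"
  shows "column_group n lam T = level_group {1..n} (entry_col lam T)"
proof -
  have "column_entries lam T j = {v \<in> {1..n}. entry_col lam T v = j}" for j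
  proof
    show "column_entries lam T j \<subseteq> {v \<in> {1..n}. entry_col lam T v = j}"
      unfolding column_entries_def using tableau_in[OF T] entry_col_tableau[OF T] by blast
    show "{v \<in> {1..n}. entry_col lam T v = j} \<subseteq> column_entries lam T j"
    proof
      fix v assume "v \<in> {v \<in> {1..n}. entry_col lam T v = j}"
      hence v: "v \<in> {1..n}" "entry_col lam T v = j" by auto
      obtain r c where rc: "(r, c) \<in> diagram lam" "v = T (r, c)" using tableau_entryE[OF T v(1)] .
      moreover have "c = j" using v(2) rc by (simp add: entry_col_tableau[OF T])
      ultimately show "v \<in> column_entries lam T j" unfolding column_entries_def by blast
    qed
  qed
  thus ?thesis
    by (simp add: column_group_def sym_group_def fibre_stabilizer_eq_level_group[symmetric])
qed

section \<open>The left ideal in coordinates\<close>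

lemma ga_mult_eq:
  "ga_mult n x y p =
    (if p permutes {1..n} then \<Sum>t | t permutes {1..n}. x (p \<circ> inv' t) * y t else 0)"
proof (cases "p permutes {1..n}")
  case True
  have "ga_mult n x y p = (\<Sum>t | t permutes {1..n}. x (p \<circ> inv' t) * y t)"
    unfolding ga_mult_def
    by (rule sum.reindex_bij_witness[of _ "\<lambda>t. (p \<circ> inv' t, t)" snd])
      (use True in \<open>auto simp: sym_group_def comp_assoc permutes_inv_o
         intro: permutes_compose permutes_inv\<close>)
  with True show ?thesis by simp
next
  case False
  hence empty: "{(s, t). s \<in> carrier (sym_group n) \<and> t \<in> carrier (sym_group n) \<and>
      s \<otimes>\<^bsub>sym_group n\<^esub> t = p} = {}"
    by (auto simp: sym_group_def intro: permutes_compose)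
  show ?thesis unfolding ga_mult_def empty using False by simp
qed

lemma sum_permutes_restrict:
  fixes h :: "(nat \<Rightarrow> nat) \<Rightarrow> 'k::field"
  assumes "\<And>t. t permutes {1..n} \<Longrightarrow> t \<notin> S \<Longrightarrow> h t = 0" "S \<subseteq> {t. t permutes {1..n}}"
  shows "(\<Sum>t | t permutes {1..n}. h t) = (\<Sum>t\<in>S. h t)"
  by (rule sum.mono_neutral_right) (use assms in \<open>auto simp: finite_permutations\<close>)

lemma row_sum_eq:
  assumes T: "is_tableau n lam T"
  shows "row_sum n lam T p = (if p \<in> level_group {1..n} (entry_row lam T) then 1 else 0)"
  unfolding row_sum_def ga_of_def row_group_eq[OF T]
  by (simp add: finite_level_group)

lemma column_sum_eq:
  assumes T: "is_tableau n lam T"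
  shows "column_sum n lam T p =
    (if p \<in> level_group {1..n} (entry_col lam T) then of_int (sign p) else 0)"
proof -
  have "column_sum n lam T p = (\<Sum>s\<in>level_group {1..n} (entry_col lam T).
      if p = s then of_int (sign s) else 0)"
    unfolding column_sum_def ga_of_def column_group_eq[OF T] by (rule sum.cong) auto
  thus ?thesis by (simp add: finite_level_group)
qed

abbreviation tab_mult where
  "tab_mult n lam T \<equiv> young_shape.young_mult {1..n} (entry_row lam T) (entry_col lam T)"

abbreviation tab_coeff where
  "tab_coeff n lam T \<equiv> young_shape.young_coeff {1..n} (entry_row lam T) (entry_col lam T)"

lemma ga_mult_row_column:
  fixes x :: "(nat \<Rightarrow> nat) \<Rightarrow> 'k::field_char_0"
  assumes lam: "is_partition n lam" and T: "is_tableau n lam T"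
  shows "ga_mult n (ga_mult n x (row_sum n lam T)) (column_sum n lam T)
    = (\<lambda>p. if p permutes {1..n} then tab_mult n lam T x p else 0)"
proof
  fix p
  interpret young_shape "{1..n}" "entry_row lam T" "entry_col lam T"
    by (rule tableau_shape[OF lam T])
  have sub: "R \<subseteq> {t. t permutes {1..n}}" "C \<subseteq> {t. t permutes {1..n}}"
    by (auto dest: level_groupD)
  have row: "ga_mult n x (row_sum n lam T) q = (\<Sum>a\<in>R. x (q \<circ> inv' a))"
    if "q permutes {1..n}" for q
  proof -
    have "ga_mult n x (row_sum n lam T) q
      = (\<Sum>t | t permutes {1..n}. x (q \<circ> inv' t) * row_sum n lam T t)"
      using that by (simp add: ga_mult_eq)
    also have "\<dots> = (\<Sum>a\<in>R. x (q \<circ> inv' a) * row_sum n lam T a)"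
      by (rule sum_permutes_restrict[OF _ sub(1)]) (simp add: row_sum_eq[OF T])
    also have "\<dots> = (\<Sum>a\<in>R. x (q \<circ> inv' a))"
      by (rule sum.cong) (simp_all add: row_sum_eq[OF T])
    finally show ?thesis .
  qed
  show "ga_mult n (ga_mult n x (row_sum n lam T)) (column_sum n lam T) p
    = (if p permutes {1..n} then tab_mult n lam T x p else 0)"
  proof (cases "p permutes {1..n}")
    case True
    have "ga_mult n (ga_mult n x (row_sum n lam T)) (column_sum n lam T) p
      = (\<Sum>t | t permutes {1..n}. ga_mult n x (row_sum n lam T) (p \<circ> inv' t) * column_sum n lam T t)"
      using True unfolding ga_mult_eq[of n "ga_mult n x (row_sum n lam T)"] by simp
    also have "\<dots> = (\<Sum>b\<in>C. ga_mult n x (row_sum n lam T) (p \<circ> inv' b) * column_sum n lam T b)"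
      by (rule sum_permutes_restrict[OF _ sub(2)]) (simp add: column_sum_eq[OF T])
    also have "\<dots> = tab_mult n lam T x p"
      unfolding young_mult_def
    proof (rule sum.cong[OF refl])
      fix b assume b: "b \<in> C"
      have "p \<circ> inv' b permutes {1..n}"
        using True level_groupD(1)[OF b] by (intro permutes_compose permutes_inv)
      thus "ga_mult n x (row_sum n lam T) (p \<circ> inv' b) * column_sum n lam T b
          = of_int (sign b) * (\<Sum>a\<in>R. x (p \<circ> inv' b \<circ> inv' a))"
        using b by (simp add: row column_sum_eq[OF T])
    qed
    finally show ?thesis using True by simp
  qed (simp add: ga_mult_eq)
qed

lemma young_ideal_eq:
  fixes T :: "nat \<times> nat \<Rightarrow> nat"
  assumes "is_partition n lam" "is_tableau n lam T"
  shows "(young_ideal n lam T :: ((nat \<Rightarrow> nat) \<Rightarrow> 'k::field_char_0) set) =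
    {(\<lambda>p. if p permutes {1..n} then tab_mult n lam T x p else 0) | x. x \<in> group_algebra n}"
  unfolding young_ideal_def ga_mult_row_column[OF assms] ..

lemma ga_of_mult:
  assumes s: "s permutes {1..n}"
  shows "ga_mult n (ga_of s) y = (\<lambda>p. if p permutes {1..n} then y (inv' s \<circ> p) else 0)"
proof
  fix p
  show "ga_mult n (ga_of s) y p = (if p permutes {1..n} then y (inv' s \<circ> p) else 0)"
  proof (cases "p permutes {1..n}")
    case True
    have "p \<circ> inv' t = s \<longleftrightarrow> t = inv' s \<circ> p" if t: "t permutes {1..n}" for t
    proof
      assume "p \<circ> inv' t = s"
      hence "p \<circ> (inv' t \<circ> t) = s \<circ> t" by (metis comp_assoc)
      hence "p = s \<circ> t" by (simp add: permutes_inv_o[OF t])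
      thus "t = inv' s \<circ> p" by (metis comp_assoc id_comp permutes_inv_o(2)[OF s])
    next
      assume "t = inv' s \<circ> p"
      hence "s \<circ> t = p" by (metis comp_assoc id_comp permutes_inv_o(1)[OF s])
      thus "p \<circ> inv' t = s" by (metis comp_assoc comp_id permutes_inv_o(1)[OF t])
    qed
    hence "ga_mult n (ga_of s) y p = (\<Sum>t | t permutes {1..n}. if t = inv' s \<circ> p then y t else 0)"
      using True unfolding ga_mult_eq ga_of_def by (simp, intro sum.cong) auto
    also have "\<dots> = y (inv' s \<circ> p)"
      using permutes_compose[OF True permutes_inv[OF s]] by (simp add: finite_permutations)
    finally show ?thesis using True by simp
  qed (simp add: ga_mult_eq)
qed

text \<open>The translates of the coefficient function by group elements are the natural generators of the ideal.\<close>

lemma (in young_shape) young_mult_ga_of: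
  assumes g: "g permutes V" and p: "p permutes V"
  shows "young_mult (ga_of g) p = (of_int (young_coeff (inv' g \<circ> p)) :: 'k::field_char_0)"
proof -
  have "(\<Sum>a\<in>R. ga_of g (p \<circ> inv' b \<circ> inv' a)) = (if inv' g \<circ> p \<circ> inv' b \<in> R then 1 else (0 :: 'k))"
    (is "?l = _") if b: "b \<in> C" for b
  proof -
    have "p \<circ> inv' b \<circ> inv' a = g \<longleftrightarrow> a = inv' g \<circ> p \<circ> inv' b" if a: "a \<in> R" for a
    proof
      note pa = level_groupD(1)[OF a]
      assume "p \<circ> inv' b \<circ> inv' a = g"
      hence "p \<circ> inv' b = g \<circ> a" by (metis comp_assoc comp_id permutes_inv_o(2)[OF pa])
      thus "a = inv' g \<circ> p \<circ> inv' b" by (metis comp_assoc id_comp permutes_inv_o(2)[OF g])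
    next
      note pa = level_groupD(1)[OF a]
      assume "a = inv' g \<circ> p \<circ> inv' b"
      hence "g \<circ> a = p \<circ> inv' b" by (metis comp_assoc id_comp permutes_inv_o(1)[OF g])
      thus "p \<circ> inv' b \<circ> inv' a = g" by (metis comp_assoc comp_id permutes_inv_o(1)[OF pa])
    qed
    hence "?l = (\<Sum>a\<in>R. if a = inv' g \<circ> p \<circ> inv' b then 1 else 0)"
      unfolding ga_of_def by (intro sum.cong) auto
    thus ?thesis using finite_level_group[OF fin] by simp
  qed
  thus ?thesis unfolding young_mult_def young_coeff_def of_int_sum
    by (intro sum.cong) auto
qed

lemma level_group_conj:
  assumes t: "t permutes V" and f: "\<And>v. v \<in> V \<Longrightarrow> f' (t v) = f v"
  shows "t \<circ> p \<circ> inv' t \<in> level_group V f' \<longleftrightarrow> p \<in> level_group V f"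
proof -
  have aux: "t \<circ> p \<circ> inv' t \<in> level_group V f'"
    if t: "t permutes V" and f: "\<And>v. v \<in> V \<Longrightarrow> f' (t v) = f v" and p: "p \<in> level_group V f"
    for t p and f f' :: "nat \<Rightarrow> nat"
  proof -
    note pp = level_groupD(1)[OF p]
    have "f' (t (p (inv' t v))) = f' v" if "v \<in> V" for v
    proof -
      have v: "inv' t v \<in> V" using that permutes_inv[OF t] by (simp add: permutes_in_image)
      hence "f' (t (p (inv' t v))) = f (inv' t v)"
        using f level_groupD(2)[OF p v] permutes_in_image[OF pp] by simp
      also have "\<dots> = f' v" using f[OF v] by (simp add: permutes_inverses[OF t])
      finally show ?thesis .
    qed
    moreover have "t \<circ> p \<circ> inv' t permutes V"
      using t pp by (intro permutes_compose permutes_inv)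
    ultimately show ?thesis by (simp add: level_group_def)
  qed
  show ?thesis
  proof
    assume "p \<in> level_group V f"
    with t f show "t \<circ> p \<circ> inv' t \<in> level_group V f'" by (rule aux)
  next
    assume a: "t \<circ> p \<circ> inv' t \<in> level_group V f'"
    have "inv' t \<circ> (t \<circ> p \<circ> inv' t) \<circ> inv' (inv' t) \<in> level_group V f"
    proof (rule aux[OF permutes_inv[OF t] _ a])
      fix v assume "v \<in> V"
      hence "inv' t v \<in> V" using permutes_inv[OF t] by (simp add: permutes_in_image)
      from f[OF this] show "f (inv' t v) = f' v" by (simp add: permutes_inverses[OF t])
    qed
    moreover have "inv' t \<circ> (t \<circ> p \<circ> inv' t) \<circ> inv' (inv' t) = p"
      by (simp add: fun_eq_iff permutes_inv_inv[OF t] permutes_inverses[OF t])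
    ultimately show "p \<in> level_group V f" by simp
  qed
qed

text \<open>Relabelling the entries by \<open>t\<close> conjugates the row group and the column group by \<open>t\<close>, and
  conjugation preserves the sign.\<close>

lemma young_coeff_conj:
  assumes Y: "young_shape V rw cl" "young_shape V rw' cl'" and t: "t permutes V"
    and rw: "\<And>v. v \<in> V \<Longrightarrow> rw' (t v) = rw v" and cl: "\<And>v. v \<in> V \<Longrightarrow> cl' (t v) = cl v"
  shows "young_shape.young_coeff V rw' cl' (t \<circ> h \<circ> inv' t) = young_shape.young_coeff V rw cl h"
proof -
  note fin = young_shape.fin[OF Y(1)]
  have conj_cl: "t \<circ> p \<circ> inv' t \<in> level_group V cl' \<longleftrightarrow> p \<in> level_group V cl" for p
    using t cl by (rule level_group_conj)
  have conj_rw: "t \<circ> p \<circ> inv' t \<in> level_group V rw' \<longleftrightarrow> p \<in> level_group V rw" for p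
    using t rw by (rule level_group_conj)
  have "young_shape.young_coeff V rw' cl' (t \<circ> h \<circ> inv' t) =
    (\<Sum>b\<in>level_group V cl'. if t \<circ> h \<circ> inv' t \<circ> inv' b \<in> level_group V rw' then sign b else 0)"
    by (rule young_shape.young_coeff_def[OF Y(2)])
  also have "\<dots> = (\<Sum>b\<in>level_group V cl.
    if t \<circ> h \<circ> inv' t \<circ> inv' (t \<circ> b \<circ> inv' t) \<in> level_group V rw' then sign (t \<circ> b \<circ> inv' t) else 0)"
  proof (rule sum.reindex_bij_witness[of _ "\<lambda>b. t \<circ> b \<circ> inv' t" "\<lambda>b. inv' t \<circ> b \<circ> t"])
    fix b assume b: "b \<in> level_group V cl'"
    show eq: "t \<circ> (inv' t \<circ> b \<circ> t) \<circ> inv' t = b"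
      by (simp add: fun_eq_iff permutes_inverses[OF t])
    show "inv' t \<circ> b \<circ> t \<in> level_group V cl"
      using conj_cl[of "inv' t \<circ> b \<circ> t"] b unfolding eq by blast
    show "(if t \<circ> h \<circ> inv' t \<circ> inv' (t \<circ> (inv' t \<circ> b \<circ> t) \<circ> inv' t) \<in> level_group V rw'
        then sign (t \<circ> (inv' t \<circ> b \<circ> t) \<circ> inv' t) else 0) =
        (if t \<circ> h \<circ> inv' t \<circ> inv' b \<in> level_group V rw' then sign b else 0)"
      unfolding eq ..
  next
    fix b assume b: "b \<in> level_group V cl"
    show "inv' t \<circ> (t \<circ> b \<circ> inv' t) \<circ> t = b"
      by (simp add: fun_eq_iff permutes_inverses[OF t])
    show "t \<circ> b \<circ> inv' t \<in> level_group V cl'" using conj_cl b by blast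
  qed
  also have "\<dots> = (\<Sum>b\<in>level_group V cl. if h \<circ> inv' b \<in> level_group V rw then sign b else 0)"
  proof (rule sum.cong[OF refl])
    fix b assume "b \<in> level_group V cl"
    note b = level_groupD(1)[OF this]
    have tb: "t \<circ> b permutes V" using permutes_compose[OF b t] .
    note ti = permutes_inv[OF t]
    have "inv' (t \<circ> b \<circ> inv' t) = t \<circ> inv' b \<circ> inv' t"
      by (subst inv_comp_permutes[OF tb ti], subst inv_comp_permutes[OF t b])
        (simp add: permutes_inv_inv[OF t] comp_assoc)
    hence "t \<circ> h \<circ> inv' t \<circ> inv' (t \<circ> b \<circ> inv' t) = t \<circ> (h \<circ> inv' b) \<circ> inv' t"
      by (simp add: fun_eq_iff permutes_inverses[OF t])
    moreover have "sign (t \<circ> b \<circ> inv' t) = sign b"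
      by (simp add: sign_comp_permutes[OF fin tb ti] sign_comp_permutes[OF fin t b]
          sign_inv_permutes[OF fin t])
    ultimately show "(if t \<circ> h \<circ> inv' t \<circ> inv' (t \<circ> b \<circ> inv' t) \<in> level_group V rw'
        then sign (t \<circ> b \<circ> inv' t) else 0) = (if h \<circ> inv' b \<in> level_group V rw then sign b else 0)"
      using conj_rw by simp
  qed
  also have "\<dots> = young_shape.young_coeff V rw cl h"
    by (rule young_shape.young_coeff_def[OF Y(1), symmetric])
  finally show ?thesis .
qed

section \<open>The permutation carrying one tableau to another\<close>

definition tab_perm :: "nat \<Rightarrow> nat list \<Rightarrow> (nat \<times> nat \<Rightarrow> nat) \<Rightarrow> (nat \<times> nat \<Rightarrow> nat) \<Rightarrow> nat \<Rightarrow> nat" where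
  "tab_perm n lam T S v = (if v \<in> {1..n} then S (inv_into (diagram lam) T v) else v)"

lemma tab_perm_apply:
  assumes T: "is_tableau n lam T" and x: "x \<in> diagram lam"
  shows "tab_perm n lam T S (T x) = S x"
proof -
  have "inv_into (diagram lam) T (T x) = x"
    using T x by (simp add: is_tableau_def bij_betw_def)
  thus ?thesis using tableau_in[OF T x] by (simp add: tab_perm_def)
qed

lemma tab_perm_permutes:
  assumes T: "is_tableau n lam T" and S: "is_tableau n lam S"
  shows "tab_perm n lam T S permutes {1..n}"
proof (rule bij_imp_permutes)
  have "bij_betw (S \<circ> inv_into (diagram lam) T) {1..n} {1..n}"
    using T S unfolding is_tableau_def by (metis bij_betw_inv_into bij_betw_trans)
  thus "bij_betw (tab_perm n lam T S) {1..n} {1..n}"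
    by (rule bij_betw_cong[THEN iffD1, rotated]) (simp add: tab_perm_def)
qed (auto simp: tab_perm_def)

lemma tab_perm_unique:
  assumes T: "is_tableau n lam T" and p: "p permutes {1..n}"
    and eq: "\<And>x. x \<in> diagram lam \<Longrightarrow> p (T x) = S x"
  shows "tab_perm n lam T S = p"
proof
  fix v
  show "tab_perm n lam T S v = p v"
  proof (cases "v \<in> {1..n}")
    case True
    from tableau_entryE[OF T this] show ?thesis
      by (metis eq tab_perm_apply[OF T])
  qed (use permutes_not_in[OF p] in \<open>auto simp: tab_perm_def\<close>)
qed

lemma tab_perm_comp:
  assumes T: "is_tableau n lam T" and S: "is_tableau n lam S" and U: "is_tableau n lam U"
  shows "tab_perm n lam T U \<circ> inv' (tab_perm n lam T S) = tab_perm n lam S U"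
proof (rule tab_perm_unique[OF S, symmetric])
  note pTS = tab_perm_permutes[OF T S]
  show "tab_perm n lam T U \<circ> inv' (tab_perm n lam T S) permutes {1..n}"
    by (rule permutes_compose[OF permutes_inv[OF pTS] tab_perm_permutes[OF T U]])
  fix x assume x: "x \<in> diagram lam"
  have "inv' (tab_perm n lam T S) (S x) = T x"
    by (simp add: permutes_inv_eq[OF pTS] tab_perm_apply[OF T x])
  thus "(tab_perm n lam T U \<circ> inv' (tab_perm n lam T S)) (S x) = U x"
    by (simp add: tab_perm_apply[OF T x])
qed

text \<open>The right-hand side is an entry of the matrix computed in the ideal of \<open>T\<close>; on the left
  \<open>T\<close> does not occur. Conjugation by the permutation from \<open>T\<close> to \<open>S\<close> relates the two.\<close>

lemma tab_coeff_transport: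
  assumes lam: "is_partition n lam" and T: "is_tableau n lam T"
    and S: "is_tableau n lam S" and U: "is_tableau n lam U"
  shows "tab_coeff n lam S (g \<circ> tab_perm n lam S U) =
    tab_coeff n lam T (inv' (tab_perm n lam T S) \<circ> g \<circ> tab_perm n lam T U)"
proof -
  let ?t = "tab_perm n lam T S"
  note t = tab_perm_permutes[OF T S]
  have "?t \<circ> (inv' ?t \<circ> g \<circ> tab_perm n lam T U) \<circ> inv' ?t = g \<circ> (tab_perm n lam T U \<circ> inv' ?t)"
    by (simp add: fun_eq_iff permutes_inverses[OF t])
  hence eq: "?t \<circ> (inv' ?t \<circ> g \<circ> tab_perm n lam T U) \<circ> inv' ?t = g \<circ> tab_perm n lam S U"
    by (simp add: tab_perm_comp[OF T S U])
  have "entry_row lam S (?t v) = entry_row lam T v" "entry_col lam S (?t v) = entry_col lam T v"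
    if "v \<in> {1..n}" for v
    using tableau_entryE[OF T that]
    by (metis tab_perm_apply[OF T] entry_row_tableau[OF T] entry_row_tableau[OF S],
        metis tab_perm_apply[OF T] entry_col_tableau[OF T] entry_col_tableau[OF S])
  from young_coeff_conj[OF tableau_shape[OF lam T] tableau_shape[OF lam S] t this,
      of "inv' ?t \<circ> g \<circ> tab_perm n lam T U"]
  show ?thesis unfolding eq .
qed

lemma standard_iff_is_standard:
  assumes lam: "is_partition n lam" and T: "is_tableau n lam T"
    and eq: "\<And>x. x \<in> diagram lam \<Longrightarrow> p (T x) = S x"
  shows "young_shape.standard {1..n} (entry_row lam T) (entry_col lam T) p \<longleftrightarrow> is_standard lam S"
proof -
  interpret young_shape "{1..n}" "entry_row lam T" "entry_col lam T"
    by (rule tableau_shape[OF lam T])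
  note er = entry_row_tableau[OF T] and ec = entry_col_tableau[OF T]
  show ?thesis
  proof
    assume std: "standard p"
    have 1: "S (i, j) < S (i, j')" if "(i, j) \<in> diagram lam" "(i, j') \<in> diagram lam" "j < j'" for i j j'
      using std tableau_in[OF T that(1)] tableau_in[OF T that(2)] er[OF that(1)] er[OF that(2)]
        ec[OF that(1)] ec[OF that(2)] that eq[OF that(1)] eq[OF that(2)]
      unfolding standard_def by metis
    have 2: "S (i, j) < S (i', j)" if "(i, j) \<in> diagram lam" "(i', j) \<in> diagram lam" "i < i'" for i i' j
      using std tableau_in[OF T that(1)] tableau_in[OF T that(2)] er[OF that(1)] er[OF that(2)]
        ec[OF that(1)] ec[OF that(2)] that eq[OF that(1)] eq[OF that(2)]
      unfolding standard_def by metis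
    show "is_standard lam S" unfolding is_standard_def using 1 2 by blast
  next
    assume std: "is_standard lam S"
    show "standard p" unfolding standard_def
    proof (intro conjI ballI impI; elim conjE)
      fix u v assume uv: "u \<in> {1..n}" "v \<in> {1..n}"
      obtain i j where u: "(i, j) \<in> diagram lam" "u = T (i, j)" using tableau_entryE[OF T uv(1)] .
      obtain i' j' where v: "(i', j') \<in> diagram lam" "v = T (i', j')" using tableau_entryE[OF T uv(2)] .
      {
        assume "entry_row lam T u = entry_row lam T v" "entry_col lam T u < entry_col lam T v"
        hence "i = i'" "j < j'" using u v by (simp_all add: er ec)
        thus "p u < p v" using std u v eq unfolding is_standard_def by metis
      }
      {
        assume "entry_col lam T u = entry_col lam T v" "entry_row lam T u < entry_row lam T v"
        hence "j = j'" "i < i'" using u v by (simp_all add: er ec)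
        thus "p u < p v" using std u v eq unfolding is_standard_def by metis
      }
    qed
  qed
qed

section \<open>Evaluation at the standard tableaux\<close>

text \<open>Facts about the entries are stated for \<open>{1..n}\<close> and would no longer match once \<open>1\<close> is
  rewritten to \<open>Suc 0\<close>.\<close>

declare One_nat_def [simp del]

lemma (in young_shape) young_mult_linear:
  "young_mult (\<lambda>q. a * x q + y q) p = a * young_mult x p + young_mult y p"
  by (simp add: young_mult_def sum.distrib sum_distrib_left distrib_left mult.left_commute)

lemma injective_mat_inverse:
  fixes A :: "'k::field mat"
  assumes A: "A \<in> carrier_mat m m"
    and inj: "\<And>v. v \<in> carrier_vec m \<Longrightarrow> A *\<^sub>v v = 0\<^sub>v m \<Longrightarrow> v = 0\<^sub>v m"
  obtains c where "c \<in> carrier_mat m m" "A * c = 1\<^sub>m m" "c * A = 1\<^sub>m m"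
proof -
  have "det A \<noteq> 0" using det_0_iff_vec_prod_zero_field[OF A] inj by blast
  from det_non_zero_imp_unit[OF A this, of "()"] that show thesis
    unfolding Units_def ring_mat_def by auto
qed

locale standard_enumeration =
  fixes n :: nat and lam :: "nat list" and m :: nat and std_tab :: "nat \<Rightarrow> nat \<times> nat \<Rightarrow> nat"
  assumes lam: "is_partition n lam"
    and std_tab: "bij_betw std_tab {..<m} {T. is_tableau n lam T \<and> is_standard lam T}"
begin

text \<open>The tableau that determines the coefficient is the one of the column index, so that no
  reference tableau enters the definition.\<close>

definition coeff_mat :: "(nat \<Rightarrow> nat) \<Rightarrow> 'k::field_char_0 mat" where
  "coeff_mat s = mat m m (\<lambda>(k, j).
     of_int (tab_coeff n lam (std_tab j) (inv' s \<circ> tab_perm n lam (std_tab j) (std_tab k))))"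

lemma coeff_mat_carrier [simp]: "coeff_mat s \<in> carrier_mat m m"
  and dim_coeff_mat [simp]: "dim_row (coeff_mat s) = m" "dim_col (coeff_mat s) = m"
  by (simp_all add: coeff_mat_def)

lemma std_tab_tableau: "k < m \<Longrightarrow> is_tableau n lam (std_tab k)"
  and std_tab_standard: "k < m \<Longrightarrow> is_standard lam (std_tab k)"
  using bij_betwE[OF std_tab] by auto

lemma coeff_mat_range:
  assumes "k < m" "j < m"
  shows "coeff_mat s $$ (k, j) \<in> {-1, 0, 1}"
proof -
  have "coeff_mat s $$ (k, j) = of_int (tab_coeff n lam (std_tab j) (inv' s \<circ> tab_perm n lam (std_tab j) (std_tab k)))"
    using assms by (simp add: coeff_mat_def)
  thus ?thesis
    using young_shape.young_coeff_range[OF tableau_shape[OF lam std_tab_tableau[OF assms(2)]],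
        of "inv' s \<circ> tab_perm n lam (std_tab j) (std_tab k)"]
    by auto
qed

end

locale tableau_coordinates = standard_enumeration +
  fixes T :: "nat \<times> nat \<Rightarrow> nat"
  assumes T: "is_tableau n lam T"

sublocale tableau_coordinates \<subseteq> young_shape "{1..n}" "entry_row lam T" "entry_col lam T"
  by (rule tableau_shape[OF lam T])

context tableau_coordinates
begin

definition std_perm :: "nat \<Rightarrow> nat \<Rightarrow> nat" where
  "std_perm k = tab_perm n lam T (std_tab k)"

lemma std_perm_permutes: "k < m \<Longrightarrow> std_perm k permutes {1..n}"
  unfolding std_perm_def by (rule tab_perm_permutes[OF T std_tab_tableau])

lemma std_perm_standard: "k < m \<Longrightarrow> standard (std_perm k)"
  using standard_iff_is_standard[OF lam T, of "std_perm k" "std_tab k"] std_tab_standard[of k]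
  by (simp add: std_perm_def tab_perm_apply[OF T])

lemma std_perm_inj:
  assumes "k < m" "j < m" "std_perm k = std_perm j"
  shows "k = j"
proof -
  have "std_tab k x = std_tab j x" for x
  proof (cases "x \<in> diagram lam")
    case True
    thus ?thesis using assms(3) tab_perm_apply[OF T True] unfolding std_perm_def by metis
  next
    case False
    have "std_tab k \<in> extensional (diagram lam)" "std_tab j \<in> extensional (diagram lam)"
      using std_tab_tableau assms(1,2) by (auto simp: is_tableau_def)
    thus ?thesis using extensional_arb[OF _ False] by metis
  qed
  hence "std_tab k = std_tab j" by blast
  thus ?thesis using assms(1,2) std_tab by (auto simp: bij_betw_def inj_on_def)
qed

lemma standard_is_std_perm:
  assumes p: "p permutes {1..n}" "standard p"
  obtains k where "k < m" "p = std_perm k"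
proof -
  define S where "S = restrict (p \<circ> T) (diagram lam)"
  have eq: "p (T x) = S x" if "x \<in> diagram lam" for x using that by (simp add: S_def)
  have "bij_betw (p \<circ> T) (diagram lam) {1..n}"
    using T permutes_imp_bij[OF p(1)] bij_betw_trans unfolding is_tableau_def by blast
  hence "is_tableau n lam S"
    unfolding is_tableau_def S_def by simp
  moreover have "is_standard lam S"
    using standard_iff_is_standard[where p = p and S = S, OF lam T] eq p(2) by blast
  ultimately have "S \<in> std_tab ` {..<m}" using std_tab by (simp add: bij_betw_def)
  then obtain k where k: "k < m" "S = std_tab k" by auto
  have "std_perm k = p"
    unfolding std_perm_def k(2)[symmetric] by (rule tab_perm_unique[OF T p(1) eq])
  with k that show thesis by blast
qed

text \<open>In terms of a reference tableau \<open>T\<close>, the entries are values of translated generators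
  of the ideal of \<open>T\<close>.\<close>

lemma coeff_mat_entry:
  assumes "k < m" "j < m"
  shows "coeff_mat s $$ (k, j) = of_int (young_coeff (inv' (std_perm j) \<circ> inv' s \<circ> std_perm k))"
  using assms tab_coeff_transport[OF lam T std_tab_tableau std_tab_tableau, of j k "inv' s"]
  by (simp add: coeff_mat_def std_perm_def)

definition ideal :: "((nat \<Rightarrow> nat) \<Rightarrow> 'k::field_char_0) set" where
  "ideal = young_ideal n lam T"

definition generator :: "(nat \<Rightarrow> nat) \<Rightarrow> (nat \<Rightarrow> nat) \<Rightarrow> 'k::field_char_0" where
  "generator g p = (if p permutes {1..n} then of_int (young_coeff (inv' g \<circ> p)) else 0)"

definition ev :: "((nat \<Rightarrow> nat) \<Rightarrow> 'k::field_char_0) \<Rightarrow> 'k vec" where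
  "ev y = vec m (\<lambda>k. y (std_perm k))"

lemma ev_carrier [simp]: "ev y \<in> carrier_vec m"
  by (simp add: ev_def)

lemma ideal_iff:
  "y \<in> ideal \<longleftrightarrow> (\<exists>x\<in>group_algebra n. y = (\<lambda>p. if p permutes {1..n} then young_mult x p else 0))"
  unfolding ideal_def young_ideal_eq[OF lam T] by blast

lemma generator_ideal:
  assumes g: "g permutes {1..n}"
  shows "generator g \<in> ideal"
proof -
  have "(ga_of g :: _ \<Rightarrow> 'a) \<in> group_algebra n"
    using g by (auto simp: group_algebra_def ga_of_def sym_group_def)
  moreover have "generator g = (\<lambda>p. if p permutes {1..n} then young_mult (ga_of g) p else 0)"
    by (simp add: fun_eq_iff generator_def young_mult_ga_of[OF g])
  ultimately show ?thesis unfolding ideal_iff by blast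
qed

lemma ideal_linear:
  assumes "y \<in> ideal" "z \<in> ideal"
  shows "(\<lambda>p. a * y p + z p) \<in> ideal"
proof -
  obtain u v where u: "u \<in> group_algebra n" "y = (\<lambda>p. if p permutes {1..n} then young_mult u p else 0)"
    and v: "v \<in> group_algebra n" "z = (\<lambda>p. if p permutes {1..n} then young_mult v p else 0)"
    using assms unfolding ideal_iff by blast
  have "(\<lambda>q. a * u q + v q) \<in> group_algebra n" using u v by (simp add: group_algebra_def)
  moreover have "(\<lambda>p. a * y p + z p)
      = (\<lambda>p. if p permutes {1..n} then young_mult (\<lambda>q. a * u q + v q) p else 0)"
    by (simp add: fun_eq_iff u v young_mult_linear)
  ultimately show ?thesis unfolding ideal_iff by blast
qed

lemma ideal_zero: "(\<lambda>p. 0) \<in> ideal"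
  unfolding ideal_iff
  by (rule bexI[of _ "\<lambda>p. 0"]) (auto simp: young_mult_def group_algebra_def)

lemma ideal_combination:
  assumes "\<And>j. j \<in> J \<Longrightarrow> f j \<in> ideal"
  shows "(\<lambda>p. \<Sum>j\<in>J. u j * f j p) \<in> ideal"
  using assms
proof (induction J rule: infinite_finite_induct)
  case (insert j J)
  thus ?case using ideal_linear[of "f j" "\<lambda>p. \<Sum>j\<in>J. u j * f j p" "u j"] by simp
qed (simp_all add: ideal_zero)

lemma ga_of_mult_ideal:
  assumes s: "s permutes {1..n}" and y: "y \<in> ideal"
  shows "ga_mult n (ga_of s) y \<in> ideal"
proof -
  obtain u where u: "u \<in> group_algebra n" "y = (\<lambda>p. if p permutes {1..n} then young_mult u p else 0)"
    using y unfolding ideal_iff by blast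
  have iff: "inv' s \<circ> p permutes {1..n} \<longleftrightarrow> p permutes {1..n}" for p
  proof
    assume "inv' s \<circ> p permutes {1..n}"
    from permutes_compose[OF this s] show "p permutes {1..n}"
      by (metis comp_assoc id_comp permutes_inv_o(1)[OF s])
  qed (rule permutes_compose[OF _ permutes_inv[OF s]])
  have "(\<lambda>q. u (inv' s \<circ> q)) \<in> group_algebra n"
    using u(1) iff by (simp add: group_algebra_def sym_group_def)
  moreover have "ga_mult n (ga_of s) y
      = (\<lambda>p. if p permutes {1..n} then young_mult (\<lambda>q. u (inv' s \<circ> q)) p else 0)"
    by (simp add: ga_of_mult[OF s] u(2) iff young_mult_def comp_assoc fun_eq_iff del: atLeastAtMost_iff)
  ultimately show ?thesis unfolding ideal_iff by blast
qed

lemma ga_of_mult_generator: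
  assumes s: "s permutes {1..n}" and g: "g permutes {1..n}"
  shows "ga_mult n (ga_of s) (generator g) = generator (s \<circ> g)"
proof
  fix p :: "nat \<Rightarrow> nat"
  have "inv' (s \<circ> g) \<circ> p = inv' g \<circ> (inv' s \<circ> p)"
    by (simp add: inv_comp_permutes[OF s g] comp_assoc)
  thus "ga_mult n (ga_of s) (generator g) p = generator (s \<circ> g) p"
    using permutes_compose[OF _ permutes_inv[OF s], of p]
    by (simp add: ga_of_mult[OF s] generator_def)
qed

lemma ev_eq_imp_eq:
  assumes y: "y \<in> ideal" and z: "z \<in> ideal" and eq: "ev y = ev z"
  shows "y = z"
proof -
  have "(\<lambda>p. (-1) * y p + z p) \<in> ideal" by (rule ideal_linear[OF y z])
  then obtain x where x: "(\<lambda>p. (-1) * y p + z p) = (\<lambda>p. if p permutes {1..n} then young_mult x p else 0)"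
    unfolding ideal_iff by blast
  have at: "(-1) * y p + z p = (if p permutes {1..n} then young_mult x p else 0)" for p
    using fun_cong[OF x, of p] .
  have "young_mult x p = 0" if "p permutes {1..n}" "standard p" for p
  proof -
    obtain k where k: "k < m" "p = std_perm k" using standard_is_std_perm[OF \<open>p permutes {1..n}\<close> \<open>standard p\<close>] .
    have "y p = z p" using arg_cong[OF eq, of "\<lambda>v. v $ k"] k by (simp add: ev_def)
    thus ?thesis using at[of p] \<open>p permutes {1..n}\<close> by simp
  qed
  hence "young_mult x p = 0" if "p permutes {1..n}" for p
    using that by (rule young_mult_eq_0)
  hence "z p - y p = 0" for p using at[of p] by (simp split: if_splits)
  thus ?thesis by (simp add: fun_eq_iff)
qed

text \<open>Triangularity is used without ordering the tableaux: in the row of an index \<open>k\<close> of largest weight in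
  the support of \<open>v\<close>, only the diagonal term contributes.\<close>

lemma coeff_mat_id_injective:
  assumes v: "v \<in> carrier_vec m" and Xv: "coeff_mat id *\<^sub>v v = 0\<^sub>v m"
  shows "v = 0\<^sub>v m"
proof (rule ccontr)
  assume "v \<noteq> 0\<^sub>v m"
  define J where "J = {j. j < m \<and> v $ j \<noteq> 0}"
  have "J \<noteq> {}"
  proof
    assume "J = {}"
    hence "v = 0\<^sub>v m" using v by (intro eq_vecI) (auto simp: J_def)
    with \<open>v \<noteq> 0\<^sub>v m\<close> show False ..
  qed
  moreover have "finite J" by (simp add: J_def)
  ultimately obtain k where k: "k \<in> J"
    "\<forall>j\<in>J. weight {1..n} (entry_col lam T) (std_perm j) \<le> weight {1..n} (entry_col lam T) (std_perm k)"
    using ex_maximizer[of J "\<lambda>j. weight {1..n} (entry_col lam T) (std_perm j)"] by blast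
  have km: "k < m" "v $ k \<noteq> 0" using k(1) by (auto simp: J_def)
  have entry: "coeff_mat id $$ (k, j) * v $ j = (if j = k then v $ j else 0)" if j: "j < m" for j
  proof (cases "j \<in> J")
    case True
    have "young_coeff (inv' (std_perm j) \<circ> std_perm k) = 0" if "j \<noteq> k"
      using young_coeff_triangular[OF std_perm_permutes[OF j] std_perm_standard[OF j]
          std_perm_permutes[OF km(1)] std_perm_standard[OF km(1)]] k(2) True std_perm_inj[OF j km(1)] that by blast
    thus ?thesis
      using permutes_inv_o(2)[OF std_perm_permutes[OF j]]
      by (auto simp: coeff_mat_entry[OF km(1) j] inv_id young_coeff_id)
  next
    case False
    thus ?thesis using j by (auto simp: J_def)
  qed
  have "(coeff_mat id *\<^sub>v v) $ k = (\<Sum>j<m. coeff_mat id $$ (k, j) * v $ j)"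
    using km v
    by (auto simp: scalar_prod_def atLeast0LessThan intro!: sum.cong)
  also have "\<dots> = (\<Sum>j<m. if j = k then v $ j else 0)"
    by (rule sum.cong) (simp_all add: entry)
  also have "\<dots> = v $ k" using km by simp
  finally show False using Xv km by simp
qed

end

text \<open>The matrix \<open>c\<close> is a parameter because it must not depend on the reference tableau \<open>T\<close>.\<close>

locale inverted_coordinates = tableau_coordinates +
  fixes c :: "'k::field_char_0 mat"
  assumes c: "c \<in> carrier_mat m m" "coeff_mat id * c = 1\<^sub>m m" "c * coeff_mat id = 1\<^sub>m m"
begin

definition combination :: "'k vec \<Rightarrow> (nat \<Rightarrow> nat) \<Rightarrow> 'k" where
  "combination u = (\<lambda>p. \<Sum>j<m. u $ j * generator (std_perm j) p)"

lemma combination_ideal: "combination u \<in> ideal"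
  unfolding combination_def by (rule ideal_combination) (simp add: generator_ideal std_perm_permutes)

lemma ev_ga_of_combination:
  assumes s: "s permutes {1..n}" and u: "u \<in> carrier_vec m"
  shows "ev (ga_mult n (ga_of s) (combination u)) = coeff_mat s *\<^sub>v u"
proof (rule eq_vecI)
  fix k assume "k < dim_vec (coeff_mat s *\<^sub>v u)"
  hence k: "k < m" by simp
  note pk = std_perm_permutes[OF k]
  have "generator (std_perm j) (inv' s \<circ> std_perm k) = (coeff_mat s $$ (k, j) :: 'k)" if "j < m" for j
    using permutes_compose[OF pk permutes_inv[OF s]] k that
    by (simp add: generator_def coeff_mat_entry comp_assoc)
  hence "ev (ga_mult n (ga_of s) (combination u)) $ k = (\<Sum>j<m. u $ j * coeff_mat s $$ (k, j))"
    using k pk by (simp add: ev_def ga_of_mult[OF s] combination_def)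
  also have "\<dots> = (coeff_mat s *\<^sub>v u) $ k"
    using k u
    by (auto simp: scalar_prod_def atLeast0LessThan mult.commute intro!: sum.cong)
  finally show "ev (ga_mult n (ga_of s) (combination u)) $ k = (coeff_mat s *\<^sub>v u) $ k" .
qed (simp add: ev_def)

lemma ga_of_id_mult:
  assumes "y \<in> ideal"
  shows "ga_mult n (ga_of id) y = y"
  using assms unfolding ideal_iff
  by (auto simp: ga_of_mult[OF permutes_id] inv_id fun_eq_iff)

lemma ev_combination:
  assumes u: "u \<in> carrier_vec m"
  shows "ev (combination u) = coeff_mat id *\<^sub>v u"
  using ev_ga_of_combination[OF permutes_id u] by (simp add: ga_of_id_mult combination_ideal)

lemma ev_combination_inverse:
  assumes v: "v \<in> carrier_vec m"
  shows "ev (combination (c *\<^sub>v v)) = v"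
proof -
  have "ev (combination (c *\<^sub>v v)) = coeff_mat id *\<^sub>v (c *\<^sub>v v)"
    using c v by (intro ev_combination) simp
  also have "\<dots> = (coeff_mat id * c) *\<^sub>v v"
    using assoc_mult_mat_vec[OF coeff_mat_carrier c(1) v] by simp
  finally show ?thesis using c(2) v by simp
qed

lemma combination_ev:
  assumes "y \<in> ideal"
  shows "combination (c *\<^sub>v ev y) = y"
  by (rule ev_eq_imp_eq[OF combination_ideal assms]) (simp add: ev_combination_inverse)

text \<open>Left multiplication by \<open>s\<close> in evaluation coordinates: \<open>c\<close> recovers the coefficients with respect to
  the generators, and the columns of \<open>coeff_mat s\<close> are the coordinates of their translates.\<close>

lemma ev_ga_of_mult:
  assumes s: "s permutes {1..n}" and y: "y \<in> ideal"
  shows "ev (ga_mult n (ga_of s) y) = (coeff_mat s * c) *\<^sub>v ev y"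
proof -
  have "ev (ga_mult n (ga_of s) y) = coeff_mat s *\<^sub>v (c *\<^sub>v ev y)"
    using ev_ga_of_combination[OF s, of "c *\<^sub>v ev y"] c(1) by (simp add: combination_ev[OF y])
  thus ?thesis using assoc_mult_mat_vec[OF coeff_mat_carrier c(1) ev_carrier] by simp
qed

lemma coeff_mat_col:
  assumes j: "j < m" and s: "s permutes {1..n}"
  shows "col (coeff_mat s) j = ev (generator (s \<circ> std_perm j))"
proof (rule eq_vecI)
  fix k assume "k < dim_vec (ev (generator (s \<circ> std_perm j)))"
  hence k: "k < m" by (simp add: ev_def)
  show "col (coeff_mat s) j $ k = ev (generator (s \<circ> std_perm j)) $ k"
    using k j std_perm_permutes[OF k]
    by (simp add: ev_def generator_def coeff_mat_entry inv_comp_permutes[OF s std_perm_permutes[OF j]])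
qed (simp add: ev_def)

text \<open>The columns of \<open>coeff_mat t\<close> are coordinates of elements of the ideal, to which the
  action of \<open>s\<close> in coordinates applies.\<close>

lemma coeff_mat_mult:
  assumes s: "s permutes {1..n}" and t: "t permutes {1..n}"
  shows "coeff_mat (s \<circ> t) = coeff_mat s * c * coeff_mat t"
proof (rule mat_col_eqI)
  fix j assume "j < dim_col (coeff_mat s * c * coeff_mat t)"
  hence j: "j < m" by simp
  note tj = permutes_compose[OF std_perm_permutes[OF j] t]
  have "col (coeff_mat (s \<circ> t)) j = ev (generator (s \<circ> (t \<circ> std_perm j)))"
    using coeff_mat_col[OF j permutes_compose[OF t s]] by (simp add: comp_assoc)
  also have "\<dots> = ev (ga_mult n (ga_of s) (generator (t \<circ> std_perm j)))"
    by (simp add: ga_of_mult_generator[OF s tj])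
  also have "\<dots> = (coeff_mat s * c) *\<^sub>v col (coeff_mat t) j"
    by (simp add: ev_ga_of_mult[OF s generator_ideal[OF tj]] coeff_mat_col[OF j t])
  also have "\<dots> = col (coeff_mat s * c * coeff_mat t) j"
    using j by (intro col_mult2[symmetric, OF mult_carrier_mat[OF coeff_mat_carrier c(1)]]) simp_all
  finally show "col (coeff_mat (s \<circ> t)) j = col (coeff_mat s * c * coeff_mat t) j" .
qed simp_all

lemma representation: "matrix_representation n m (\<lambda>s. coeff_mat s * c)"
proof -
  have car: "coeff_mat s * c \<in> carrier_mat m m" for s by (rule mult_carrier_mat[OF coeff_mat_carrier c(1)])
  have hom: "coeff_mat (s \<circ> t) * c = (coeff_mat s * c) * (coeff_mat t * c)"
    if "s permutes {1..n}" "t permutes {1..n}" for s t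
    using coeff_mat_mult[OF that] assoc_mult_mat[OF car coeff_mat_carrier c(1)] by simp
  have "coeff_mat s * c \<in> Units (ring_mat TYPE('k) m ())" if s: "s permutes {1..n}" for s
  proof -
    note s' = permutes_inv[OF s]
    have "(coeff_mat s * c) * (coeff_mat (inv' s) * c) = 1\<^sub>m m" "(coeff_mat (inv' s) * c) * (coeff_mat s * c) = 1\<^sub>m m"
      using hom[OF s s'] hom[OF s' s] c(2) by (simp_all add: permutes_inv_o[OF s])
    thus ?thesis using car unfolding Units_def ring_mat_def by auto
  qed
  thus ?thesis using hom
    by (simp add: matrix_representation_def hom_def units_of_def sym_group_def ring_mat_def)
qed

lemma equivalent: "equivalent_to_ideal n m (\<lambda>s. coeff_mat s * c) (ideal :: (_ \<Rightarrow> 'k) set)"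
  unfolding equivalent_to_ideal_def
proof (intro exI[of _ "\<lambda>v. combination (c *\<^sub>v v)"] conjI ballI allI)
  let ?\<phi> = "\<lambda>v. combination (c *\<^sub>v v)"
  show "bij_betw ?\<phi> (carrier_vec m) ideal"
    by (rule bij_betw_byWitness[of _ ev])
      (auto simp: ev_combination_inverse combination_ev combination_ideal)
  fix v :: "'k vec" assume v: "v \<in> carrier_vec m"
  have at: "?\<phi> v p = (\<Sum>j<m. (c *\<^sub>v v) $ j * generator (std_perm j) p)" for v p
    by (simp add: combination_def)
  show "?\<phi> (v + w) = (\<lambda>p. ?\<phi> v p + ?\<phi> w p)" if w: "w \<in> carrier_vec m" for w
    unfolding at using c(1) v w
    by (simp add: mult_add_distrib_mat_vec[OF c(1) v w] distrib_right sum.distrib)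
  show "?\<phi> (a \<cdot>\<^sub>v v) = (\<lambda>p. a * ?\<phi> v p)" for a
    unfolding at using c(1) v
    by (simp add: mult_mat_vec[OF c(1) v] sum_distrib_left mult.assoc)
  show "?\<phi> ((coeff_mat s * c) *\<^sub>v v) = ga_mult n (ga_of s) (?\<phi> v)" if "s \<in> carrier (sym_group n)" for s
  proof (rule ev_eq_imp_eq[OF combination_ideal])
    have s: "s permutes {1..n}" using that by (simp add: sym_group_def)
    show "ga_mult n (ga_of s) (?\<phi> v) \<in> ideal"
      by (rule ga_of_mult_ideal[OF s combination_ideal])
    show "ev (?\<phi> ((coeff_mat s * c) *\<^sub>v v)) = ev (ga_mult n (ga_of s) (?\<phi> v))"
      using v c(1) mult_mat_vec_carrier[OF mult_carrier_mat[OF coeff_mat_carrier c(1)] v, of s]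
      by (simp add: ev_ga_of_mult[OF s combination_ideal] ev_combination_inverse)
  qed
qed

end

lemma finite_tableaux: "finite {T. is_tableau n lam T \<and> is_standard lam T}"
proof (rule finite_subset)
  show "{T. is_tableau n lam T \<and> is_standard lam T} \<subseteq> (\<Pi>\<^sub>E x\<in>diagram lam. {1..n})"
    unfolding is_tableau_def PiE_def by (auto dest: bij_betwE)
qed (simp add: finite_PiE finite_diagram)

lemma ex_tableau:
  assumes "is_partition n lam"
  shows "\<exists>T. is_tableau n lam T"
proof -
  obtain f where f: "bij_betw f (diagram lam) {1..n}"
    using finite_same_card_bij[OF finite_diagram, of "{1..n}" lam] card_diagram[OF assms] by auto
  hence "bij_betw (restrict f (diagram lam)) (diagram lam) {1..n}" by simp
  thus ?thesis unfolding is_tableau_def by (intro exI[of _ "restrict f (diagram lam)"]) simp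
qed

theorem mainTheorem2:
  fixes n :: nat and lam :: "nat list"
  assumes "n \<ge> 1" and "is_partition n lam"
  defines "m \<equiv> num_SYT n lam"
  shows "\<exists>(c :: 'k::field_char_0 mat) (X :: (nat \<Rightarrow> nat) \<Rightarrow> 'k mat).
    c \<in> carrier_mat m m \<and> invertible_mat c \<and>
    (\<forall>s \<in> carrier (sym_group n). X s \<in> carrier_mat m m \<and>
       (\<forall>i < m. \<forall>j < m. X s $$ (i, j) \<in> {-1, 0, 1})) \<and>
    (\<forall>s \<in> carrier (sym_group n). \<forall>t \<in> carrier (sym_group n).
       X (s \<otimes>\<^bsub>sym_group n\<^esub> t) = X s * c * X t) \<and>
    matrix_representation n m (\<lambda>s. X s * c) \<and>
    equivalent_to_irrep n lam m (\<lambda>s. X s * c)"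
proof -
  obtain std_tab where std_tab: "bij_betw std_tab {..<m} {T. is_tableau n lam T \<and> is_standard lam T}"
    using ex_bij_betw_nat_finite[OF finite_tableaux[of n lam]]
    unfolding m_def num_SYT_def atLeast0LessThan by blast
  interpret standard_enumeration n lam m std_tab
    using assms(2) std_tab by unfold_locales
  have coords: "tableau_coordinates n lam m std_tab T" if "is_tableau n lam T" for T
    using that by unfold_locales
  obtain T0 where T0: "is_tableau n lam T0" using ex_tableau[OF assms(2)] ..
  obtain c :: "'k mat" where c: "c \<in> carrier_mat m m" "coeff_mat id * c = 1\<^sub>m m" "c * coeff_mat id = 1\<^sub>m m"
    using injective_mat_inverse[OF coeff_mat_carrier tableau_coordinates.coeff_mat_id_injective[OF coords[OF T0]]]
    by blast
  have inverted: "inverted_coordinates n lam m std_tab T c" if "is_tableau n lam T" for T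
    using coords[OF that] c
    by (simp add: inverted_coordinates_def inverted_coordinates_axioms_def)
  interpret inverted_coordinates n lam m std_tab T0 c by (rule inverted[OF T0])
  have inv_c: "invertible_mat c"
    unfolding invertible_mat_def inverts_mat_def
    using c by (auto intro!: exI[of _ "coeff_mat id"])
  have irrep: "equivalent_to_irrep n lam m (\<lambda>s. coeff_mat s * c)"
    unfolding equivalent_to_irrep_def
  proof (intro allI impI)
    fix T assume T: "is_tableau n lam T"
    show "equivalent_to_ideal n m (\<lambda>s. coeff_mat s * c) (young_ideal n lam T)"
      using inverted_coordinates.equivalent[OF inverted[OF T]]
      unfolding tableau_coordinates.ideal_def[OF coords[OF T]] .
  qed
  show ?thesis
  proof (intro exI[of _ c] exI[of _ coeff_mat] conjI ballI allI impI)
    fix s t assume "s \<in> carrier (sym_group n)" "t \<in> carrier (sym_group n)"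
    thus "coeff_mat (s \<otimes>\<^bsub>sym_group n\<^esub> t) = coeff_mat s * c * coeff_mat t"
      using coeff_mat_mult by (simp add: sym_group_def)
  qed (use c inv_c representation irrep coeff_mat_carrier coeff_mat_range in auto)
qed

end
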